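(* Let $\alpha\in(0,2)$ and let $\Pi$, $\mathcal{L}$ and $H=\sup_{\gamma\in\mathcal{L}}\Pi(\mathrm{graph}(\gamma))$ be as defined in the context. Then $H$ is measurable and almost surely finite. Furthermore, there exists an almost surely unique path $\gamma^*\in\mathcal{L}$ with $H=\Pi(\mathrm{graph}(\gamma^* ))$; in particular, with probability one, $$H=\max_{\gamma\in\mathcal{L}}\Pi(\mathrm{graph}(\gamma)).$$
   Context: Fix $\alpha\in(0,2)$. Let $\mathcal{L}$ be the set of paths $\gamma:[0,1]\to\mathbb{R}$ with $\gamma(1)=0$ and $|\gamma(t_1)-\gamma(t_2)|\le|t_1-t_2|$ for all $t_1,t_2\in[0,1]$, and write $\mathrm{graph}(\gamma)=\{(\gamma(t),t):t\in[0,1]\}$ (space coordinate first). Let $\Delta=\{(x,t)\in\mathbb{R}^2:0\le t\le1,\ |x|\le1-t\}$. Let $0\le X_1<X_2<\cdots$ be the points of a rate $1$ Poisson process on $\mathbb{R}_+$ and set $M_i=X_i^{-1/\alpha}$. Let $(U_i)_{i\ge1}$ be i.i.d. uniform on $\Delta$, independent of $(M_i)_{i\geq 1}$, and define the random point measure $\Pi=\sum_{i\ge1}M_i\delta_{U_i}$ on $\Delta$. The random variable $H$ is $H:=\sup_{\gamma\in\mathcal{L}}\Pi(\mathrm{graph}(\gamma))$. *)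

theory Defs
  imports "HOL-Probability.Probability"
begin

(* Paths on [0,1] are total functions that are undefined off [0,1], so that equality of
   paths is equality on [0,1]. *)
definition paths :: "(real \<Rightarrow> real) set" where
  "paths = {\<gamma> \<in> extensional {0..1}.
     \<gamma> 1 = 0 \<and> (\<forall>t1\<in>{0..1}. \<forall>t2\<in>{0..1}. \<bar>\<gamma> t1 - \<gamma> t2\<bar> \<le> \<bar>t1 - t2\<bar>)}"

definition path_graph :: "(real \<Rightarrow> real) \<Rightarrow> (real \<times> real) set" where
  "path_graph \<gamma> = {(\<gamma> t, t) | t. t \<in> {0..1}}"

definition triangle :: "(real \<times> real) set" where
  "triangle = {(x, t). 0 \<le> t \<and> t \<le> 1 \<and> \<bar>x\<bar> \<le> 1 - t}"

definition point_count :: "(nat \<Rightarrow> 'a \<Rightarrow> real) \<Rightarrow> real set \<Rightarrow> 'a \<Rightarrow> ennreal" where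
  "point_count X A \<omega> = emeasure (count_space UNIV) {i. X i \<omega> \<in> A}"

(* X 0 < X 1 < ... are the points, in increasing order, of a rate 1 Poisson process on
   [0,\<infinity>): the number of points in a set of finite Lebesgue measure m is Poisson(m), and
   the numbers of points in disjoint sets are independent. The Poisson weights are written
   out because poisson_pmf excludes the mean m = 0. *)
definition poisson_points :: "'a measure \<Rightarrow> (nat \<Rightarrow> 'a \<Rightarrow> real) \<Rightarrow> bool" where
  "poisson_points M X \<longleftrightarrow>
     (\<forall>i. X i \<in> borel_measurable M) \<and>
     (AE \<omega> in M. 0 \<le> X 0 \<omega> \<and> strict_mono (\<lambda>i. X i \<omega>)) \<and>
     (\<forall>A\<in>sets borel. A \<subseteq> {0..} \<longrightarrow> emeasure lborel A < \<infinity> \<longrightarrow>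
        (\<forall>k::nat. measure M {\<omega> \<in> space M. point_count X A \<omega> = of_nat k} =
           measure lborel A ^ k / fact k * exp (- measure lborel A))) \<and>
     (\<forall>(A :: nat \<Rightarrow> real set) n.
        (\<forall>j<n. A j \<in> sets borel \<and> A j \<subseteq> {0..}) \<longrightarrow> disjoint_family_on A {..<n} \<longrightarrow>
        prob_space.indep_vars M (\<lambda>_. borel) (\<lambda>j. point_count X (A j)) {..<n})"

definition weight :: "real \<Rightarrow> (nat \<Rightarrow> 'a \<Rightarrow> real) \<Rightarrow> nat \<Rightarrow> 'a \<Rightarrow> real" where
  "weight \<alpha> X i \<omega> = X i \<omega> powr (- 1 / \<alpha>)"

definition iid_uniform_triangle :: "'a measure \<Rightarrow> (nat \<Rightarrow> 'a \<Rightarrow> real \<times> real) \<Rightarrow> bool" where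
  "iid_uniform_triangle M U \<longleftrightarrow>
     prob_space.indep_vars M (\<lambda>_. borel) U UNIV \<and>
     (\<forall>i. distr M borel (U i) = uniform_measure lborel triangle)"

(* Independence of two random elements, as independence of the sigma-algebras they generate;
   the library's indep_var needs both to have the same type. *)
definition indep_elements ::
    "'a measure \<Rightarrow> 'b measure \<Rightarrow> ('a \<Rightarrow> 'b) \<Rightarrow> 'c measure \<Rightarrow> ('a \<Rightarrow> 'c) \<Rightarrow> bool" where
  "indep_elements M N Y N' Y' \<longleftrightarrow>
     Y \<in> measurable M N \<and> Y' \<in> measurable M N' \<and>
     prob_space.indep_set M
       (sets (vimage_algebra (space M) Y N)) (sets (vimage_algebra (space M) Y' N'))"

(* The sum over i of (weight i) times the Dirac mass at U i, as the image under i \<mapsto> U i \<omega> of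
   the measure on nat that gives i its weight; see emeasure_weighted_points. *)
definition weighted_points ::
    "real \<Rightarrow> (nat \<Rightarrow> 'a \<Rightarrow> real) \<Rightarrow> (nat \<Rightarrow> 'a \<Rightarrow> real \<times> real) \<Rightarrow> 'a \<Rightarrow> (real \<times> real) measure" where
  "weighted_points \<alpha> X U \<omega> =
     distr (density (count_space UNIV) (\<lambda>i. ennreal (weight \<alpha> X i \<omega>))) borel (\<lambda>i. U i \<omega>)"

lemma emeasure_weighted_points:
  assumes "A \<in> sets borel"
  shows "emeasure (weighted_points \<alpha> X U \<omega>) A =
           (\<Sum>i. ennreal (weight \<alpha> X i \<omega>) * indicator A (U i \<omega>))"
proof -
  have "emeasure (weighted_points \<alpha> X U \<omega>) A =
      (\<integral>\<^sup>+ i. ennreal (weight \<alpha> X i \<omega>) * indicator ((\<lambda>i. U i \<omega>) -` A) i \<partial>count_space UNIV)"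
    unfolding weighted_points_def using assms
    by (subst emeasure_distr) (auto simp: emeasure_density)
  then show ?thesis
    by (simp add: nn_integral_count_space_nat indicator_def vimage_def)
qed

lemma path_graph_borel:
  assumes "\<gamma> \<in> paths"
  shows "path_graph \<gamma> \<in> sets borel"
proof -
  have "1-lipschitz_on {0..1} \<gamma>"
    using assms by (auto simp: paths_def lipschitz_on_def dist_real_def)
  then have "continuous_on {0..1} (\<lambda>t. (\<gamma> t, t))"
    by (intro continuous_intros lipschitz_on_continuous_on)
  then have "compact ((\<lambda>t. (\<gamma> t, t)) ` {0..1})"
    by (intro compact_continuous_image) auto
  moreover have "path_graph \<gamma> = (\<lambda>t. (\<gamma> t, t)) ` {0..1}"
    by (auto simp: path_graph_def)
  ultimately show ?thesis
    by (simp add: borel_compact)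
qed

definition max_weight ::
    "real \<Rightarrow> (nat \<Rightarrow> 'a \<Rightarrow> real) \<Rightarrow> (nat \<Rightarrow> 'a \<Rightarrow> real \<times> real) \<Rightarrow> 'a \<Rightarrow> ennreal" where
  "max_weight \<alpha> X U \<omega> = (SUP \<gamma>\<in>paths. emeasure (weighted_points \<alpha> X U \<omega>) (path_graph \<gamma>))"

end

theory Submission
  imports Defs
begin

text \<open>
  Write \<open>w i\<close> for the weights and \<open>u i\<close> for the points. A path collects a set of indices whose points
  lie in the triangle and pairwise satisfy \<open>\<bar>dx\<bar> \<le> \<bar>dt\<bar>\<close>. Conversely, a Lipschitz function on any subset of
  an interval extends to the whole interval, so every such set of indices, called collectable below, is
  collected by some path (\<open>collectable_imp_path\<close>). The problem is therefore the maximisation of the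
  mass of a collectable set, and the supremum may be restricted to finite sets. As a countable supremum
  of measurable functions it is measurable, for every outcome and not only almost surely.

  Finiteness and existence both follow from one estimate: almost surely the mass that a collectable set
  can carry on the indices beyond \<open>N\<close> tends to \<open>0\<close> as \<open>N\<close> grows, uniformly in the set. The expected number
  of ordered \<open>k\<close>-chains among \<open>n\<close> uniform points is at most \<open>n^k 2^k / (2k)!\<close>, so the longest
  chain among the first \<open>4^m\<close> points is eventually at most \<open>4 * 2^m\<close> (\<open>AE_chains_short\<close>). The Poisson
  points eventually satisfy \<open>4^m / 2 \<le> X (4^m)\<close> (\<open>AE_points_grow\<close>), so the weights with index at
  least \<open>4^m\<close> are at most of order \<open>4^(-m/\<alpha>)\<close>. The indices in \<open>[4^m, 4^(m+1))\<close> thus contribute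
  \<open>O((2 * 4^(-1/\<alpha>))^m)\<close>, which is summable exactly because \<open>\<alpha> < 2\<close> (\<open>uniformly_small_tails\<close>).
  Since collectability is a condition on pairs of indices, the collectable sets form a compact subset of
  the power set of the naturals, and the uniform tails make the mass continuous on it; hence the
  supremum is finite and attained (\<open>best_attained\<close>).

  Uniqueness has two parts. If two optimal paths collect the same points but differ, the open region
  between them contains a further point, by density of the points in the triangle, and this point is
  compatible with everything collected so far; adding it would increase the maximum. If they collect
  different points, some index \<open>i\<close> lies on one path only, and then
  \<open>w i\<close> equals the best mass avoiding \<open>i\<close> minus the best mass that can be added to \<open>i\<close>. Both of these
  depend only on the other weights and on the points. Such a coincidence is null because, given the
  other Poisson points, the \<open>i\<close>-th one has a diffuse law (\<open>AE_point_ne\<close>), and the weights are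
  independent of the points, which allows the points to be fixed by Fubini's theorem.
\<close>

section \<open>Lipschitz paths through point sets\<close>

definition hits :: "('i \<Rightarrow> real \<times> real) \<Rightarrow> (real \<Rightarrow> real) \<Rightarrow> 'i set" where
  "hits u \<gamma> = {i. u i \<in> path_graph \<gamma>}"

definition timelike :: "real \<times> real \<Rightarrow> real \<times> real \<Rightarrow> bool" where
  "timelike p q \<longleftrightarrow> \<bar>fst p - fst q\<bar> \<le> \<bar>snd p - snd q\<bar>"

definition collectable :: "('i \<Rightarrow> real \<times> real) \<Rightarrow> 'i set \<Rightarrow> bool" where
  "collectable u S \<longleftrightarrow> (\<forall>i\<in>S. u i \<in> triangle) \<and> (\<forall>i\<in>S. \<forall>j\<in>S. timelike (u i) (u j))"

text \<open>
  As a measure on the indices rather than a sum, so that additivity and continuity come for free.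
\<close>

definition mass :: "(nat \<Rightarrow> real) \<Rightarrow> nat set \<Rightarrow> ennreal" where
  "mass w S = emeasure (density (count_space UNIV) (\<lambda>i. ennreal (w i))) S"

lemma closed_triangle: "closed triangle"
proof -
  have eq: "triangle = {p. 0 \<le> snd p} \<inter> {p. snd p \<le> 1} \<inter> {p. \<bar>fst p\<bar> \<le> 1 - snd p}"
    by (auto simp: triangle_def case_prod_beta)
  show ?thesis
    unfolding eq by (intro closed_Int closed_Collect_le continuous_intros)
qed

lemma triangle_sets [measurable]: "triangle \<in> sets borel"
  using closed_triangle by (rule borel_closed)

lemma timelike_commute: "timelike p q \<longleftrightarrow> timelike q p"
  by (simp add: timelike_def abs_minus_commute)

lemma collectable_mono: "collectable u S \<Longrightarrow> T \<subseteq> S \<Longrightarrow> collectable u T"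
  by (auto simp: collectable_def)

lemma path_in_triangle:
  assumes "\<gamma> \<in> paths" "t \<in> {0..1}"
  shows "\<bar>\<gamma> t\<bar> \<le> 1 - t"
proof -
  have "\<forall>s\<in>{0..1}. \<bar>\<gamma> t - \<gamma> s\<bar> \<le> \<bar>t - s\<bar>" and 1: "\<gamma> 1 = 0"
    using assms by (simp_all add: paths_def)
  from bspec[OF this(1), of 1] 1 have "\<bar>\<gamma> t\<bar> \<le> \<bar>t - 1\<bar>" by simp
  with assms(2) show ?thesis by auto
qed

lemma mem_path_graph: "p \<in> path_graph \<gamma> \<longleftrightarrow> snd p \<in> {0..1} \<and> fst p = \<gamma> (snd p)"
  by (cases p) (auto simp: path_graph_def)

lemma collectable_hits:
  assumes "\<gamma> \<in> paths"
  shows "collectable u (hits u \<gamma>)"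
proof -
  have "u i \<in> triangle" if "i \<in> hits u \<gamma>" for i
    using that path_in_triangle[OF assms, of "snd (u i)"]
    by (cases "u i") (auto simp: hits_def mem_path_graph triangle_def)
  moreover have "timelike (u i) (u j)" if "i \<in> hits u \<gamma>" "j \<in> hits u \<gamma>" for i j
    using that assms by (simp add: timelike_def hits_def mem_path_graph paths_def)
  ultimately show ?thesis
    by (simp add: collectable_def)
qed

text \<open>
  McShane's extension: the lower envelope of the cones \<open>x + \<bar>t - s\<bar>\<close> over the given points \<open>(x, s)\<close>
  is Lipschitz, and passes through each of the points because they are pairwise compatible. Adjoining
  the apex \<open>(0, 1)\<close> of the triangle, which is compatible with every point of the triangle, enforces the
  boundary condition at time \<open>1\<close>.
\<close>

lemma collectable_imp_path:
  assumes "collectable u S"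
  shows "\<exists>\<gamma>\<in>paths. S \<subseteq> hits u \<gamma>"
proof -
  define P where "P = insert (0, 1) (u ` S)"
  have tri: "\<bar>fst p\<bar> \<le> 1 - snd p" "0 \<le> snd p" "snd p \<le> 1" if "p \<in> P" for p
    using that assms by (auto simp: P_def collectable_def triangle_def case_prod_beta)
  have caus: "\<bar>fst p - fst q\<bar> \<le> \<bar>snd p - snd q\<bar>" if "p \<in> P" "q \<in> P" for p q
  proof (cases "p = (0,1) \<or> q = (0,1)")
    case True
    then show ?thesis using tri[OF that(1)] tri[OF that(2)] by auto
  next
    case False
    then show ?thesis using that assms by (auto simp: P_def collectable_def timelike_def)
  qed
  have ne: "P \<noteq> {}" by (auto simp: P_def)
  define g where "g t = (INF p\<in>P. fst p + \<bar>t - snd p\<bar>)" for t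
  have bdd: "bdd_below ((\<lambda>p. fst p + \<bar>t - snd p\<bar>) ` P)" for t
    using tri by (intro bdd_belowI2[where m="-1"]) (smt (verit))
  have lip: "g s \<le> g t + \<bar>s - t\<bar>" for s t
  proof -
    have "g s - \<bar>s - t\<bar> \<le> fst p + \<bar>t - snd p\<bar>" if "p \<in> P" for p
      using cINF_lower[OF bdd[of s] that] unfolding g_def by (smt (verit))
    then have "g s - \<bar>s - t\<bar> \<le> g t"
      unfolding g_def[of t] by (intro cINF_greatest[OF ne]) auto
    then show ?thesis by simp
  qed
  have val: "g (snd p) = fst p" if "p \<in> P" for p
  proof (rule antisym)
    show "g (snd p) \<le> fst p"
      using cINF_lower[OF bdd[of "snd p"] that] by (simp add: g_def)
    show "fst p \<le> g (snd p)"
      unfolding g_def using caus[OF that] by (intro cINF_greatest[OF ne]) (smt (verit))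
  qed
  define \<gamma> where "\<gamma> = restrict g {0..1}"
  have "g 1 = 0" using val[of "(0,1)"] by (simp add: P_def)
  moreover have "\<bar>g s - g t\<bar> \<le> \<bar>s - t\<bar>" for s t
    using lip[of s t] lip[of t s] by linarith
  ultimately have "\<gamma> \<in> paths"
    by (auto simp: paths_def \<gamma>_def)
  moreover have "i \<in> hits u \<gamma>" if "i \<in> S" for i
  proof -
    have "u i \<in> P" using that by (simp add: P_def)
    from tri[OF this] val[OF this] show ?thesis
      by (simp add: hits_def mem_path_graph \<gamma>_def)
  qed
  ultimately show ?thesis by blast
qed

lemma mass_mono: "S \<subseteq> T \<Longrightarrow> mass w S \<le> mass w T"
  unfolding mass_def by (rule emeasure_mono) auto

lemma mass_Un_disjoint: "S \<inter> T = {} \<Longrightarrow> mass w (S \<union> T) = mass w S + mass w T"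
  unfolding mass_def by (rule plus_emeasure[symmetric]) auto

lemma mass_singleton: "mass w {i} = ennreal (w i)"
proof -
  have "mass w {i} = (\<integral>\<^sup>+j. ennreal (w j) * indicator {i} j \<partial>count_space UNIV)"
    unfolding mass_def by (simp add: emeasure_density)
  also have "\<dots> = ennreal (w i)"
    by (simp add: nn_integral_indicator_singleton)
  finally show ?thesis .
qed

lemma mass_insert: "i \<notin> S \<Longrightarrow> mass w (insert i S) = ennreal (w i) + mass w S"
  using mass_Un_disjoint[of "{i}" S w] by (simp add: mass_singleton)

lemma mass_empty [simp]: "mass w {} = 0"
  by (simp add: mass_def)

lemma mass_finite: "finite F \<Longrightarrow> mass w F = (\<Sum>i\<in>F. ennreal (w i))"
  by (induction F rule: finite_induct) (auto simp: mass_insert)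

lemma mass_SUP_finite: "mass w S = (SUP n. mass w (S \<inter> {..<n}))"
proof -
  have "(\<Union>n. S \<inter> {..<n}) = S" by auto
  moreover have "(SUP n. mass w (S \<inter> {..<n})) = mass w (\<Union>n. S \<inter> {..<n})"
    unfolding mass_def by (rule SUP_emeasure_incseq) (auto simp: incseq_def)
  ultimately show ?thesis by simp
qed

lemma emeasure_weighted_points_path:
  assumes "\<gamma> \<in> paths"
  shows "emeasure (weighted_points \<alpha> X U \<omega>) (path_graph \<gamma>) =
     mass (\<lambda>i. weight \<alpha> X i \<omega>) (hits (\<lambda>i. U i \<omega>) \<gamma>)"
  unfolding weighted_points_def mass_def hits_def
  using path_graph_borel[OF assms] by (subst emeasure_distr) (auto simp: vimage_def)

definition best :: "(nat \<Rightarrow> real) \<Rightarrow> (nat \<Rightarrow> real \<times> real) \<Rightarrow> ennreal" where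
  "best w u = (SUP \<gamma>\<in>paths. mass w (hits u \<gamma>))"

lemma max_weight_eq_best:
  "max_weight \<alpha> X U \<omega> = best (\<lambda>i. weight \<alpha> X i \<omega>) (\<lambda>i. U i \<omega>)"
  unfolding max_weight_def best_def by (intro SUP_cong) (auto simp: emeasure_weighted_points_path)

lemma mass_le_best:
  assumes "collectable u S"
  shows "mass w S \<le> best w u"
proof -
  obtain \<gamma> where \<gamma>: "\<gamma> \<in> paths" "S \<subseteq> hits u \<gamma>"
    using collectable_imp_path[OF assms] by blast
  have "mass w (hits u \<gamma>) \<le> best w u"
    unfolding best_def using \<gamma>(1) by (rule SUP_upper)
  with mass_mono[OF \<gamma>(2), of w] show ?thesis by (rule order_trans)
qed

text \<open>
  Only countably many sets occur on the right, which is what makes the supremum measurable.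
\<close>

lemma best_eq_SUP_finite:
  "best w u = (SUP F\<in>{F. finite F \<and> collectable u F}. mass w F)"
proof (rule antisym)
  show "best w u \<le> (SUP F\<in>{F. finite F \<and> collectable u F}. mass w F)"
    unfolding best_def
  proof (rule SUP_least)
    fix \<gamma> assume "\<gamma> \<in> paths"
    then have "collectable u (hits u \<gamma> \<inter> {..<n})" for n
      by (rule collectable_mono[OF collectable_hits]) simp
    then show "mass w (hits u \<gamma>) \<le> (SUP F\<in>{F. finite F \<and> collectable u F}. mass w F)"
      by (subst mass_SUP_finite) (rule SUP_least, rule SUP_upper, simp)
  qed
qed (rule SUP_least, simp add: mass_le_best)

section \<open>Existence of an optimal path\<close>

lemma convergent_binary_subsequence:
  fixes h :: "nat \<Rightarrow> nat \<Rightarrow> real"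
  assumes hP: "\<forall>n. h n \<in> PiE UNIV (\<lambda>_::nat. {0, 1::real})"
  shows "\<exists>l r. l \<in> PiE UNIV (\<lambda>_::nat. {0, 1::real}) \<and> strict_mono r \<and>
    (\<forall>i. (\<lambda>n. h (r n) i) \<longlonglongrightarrow> l i)"
proof -
  have "compact (PiE UNIV (\<lambda>_::nat. {0, 1::real}))"
    using compactin_PiE[of "\<lambda>_. euclidean" UNIV "\<lambda>_::nat. {0,1::real}"]
    by (simp add: euclidean_product_topology finite_imp_compact)
  then have sc: "seq_compact (PiE UNIV (\<lambda>_::nat. {0, 1::real}))"
    by (rule compact_imp_seq_compact)
  obtain l and r :: "nat \<Rightarrow> nat" where l: "l \<in> PiE UNIV (\<lambda>_::nat. {0, 1::real})" "strict_mono r" 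
     "(h \<circ> r) \<longlonglongrightarrow> l"
    using seq_compactE[OF sc hP] by (metis (no_types))
  have "(\<lambda>n. h (r n) i) \<longlonglongrightarrow> l i" for i
    using continuous_on_tendsto_compose[OF continuous_on_product_coordinates[of i] l(3)]
    by (simp add: o_def)
  with l show ?thesis by blast
qed

text \<open>
  Along a maximising sequence of paths the collected sets subconverge pointwise, as 0-1 sequences. The
  limit set is collectable because compatibility only concerns pairs of indices, each of which is
  eventually settled. Finitely many indices are settled simultaneously and the rest carries mass at
  most \<open>e\<close>, so no mass is lost in the limit.
\<close>

lemma best_attained:
  assumes tail: "\<And>e. 0 < e \<Longrightarrow> \<exists>N. \<forall>S. collectable u S \<longrightarrow> mass w (S \<inter> {N..}) \<le> ennreal e"
  shows "best w u < \<infinity>" and "\<exists>\<gamma>\<in>paths. mass w (hits u \<gamma>) = best w u"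
proof -
  have split: "mass w S = mass w (S \<inter> {..<N}) + mass w (S \<inter> {N..})" for S N
    by (subst mass_Un_disjoint[symmetric]) (auto intro!: arg_cong[where f="mass w"])
  obtain N where N: "\<And>S. collectable u S \<Longrightarrow> mass w (S \<inter> {N..}) \<le> ennreal 1"
    using tail[of 1] by auto
  have "mass w (hits u \<gamma>) \<le> mass w {..<N} + 1" if "\<gamma> \<in> paths" for \<gamma>
    using N[OF collectable_hits[OF that]]
    by (subst split[of _ N]) (auto intro!: add_mono mass_mono)
  then have "best w u \<le> mass w {..<N} + 1"
    unfolding best_def by (rule SUP_least)
  also have "\<dots> < \<infinity>"
    by (auto simp: mass_finite ennreal_add_eq_top less_top[symmetric])
  finally show fin: "best w u < \<infinity>" .
  have "paths \<noteq> {}"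
    using collectable_imp_path[of u "{}"] by (auto simp: collectable_def)
  then obtain f where f: "range f \<subseteq> (\<lambda>\<gamma>. mass w (hits u \<gamma>)) ` paths"
      "best w u = (SUP n. f n)" "incseq f"
    unfolding best_def using ennreal_Sup_countable_SUP[of "(\<lambda>\<gamma>. mass w (hits u \<gamma>)) ` paths"] by auto
  have "\<forall>n. \<exists>\<gamma>\<in>paths. f n = mass w (hits u \<gamma>)" using f(1) by auto
  then obtain G where G: "\<And>n. G n \<in> paths" "\<And>n. f n = mass w (hits u (G n))" by metis
  have flim: "f \<longlonglongrightarrow> best w u" using f LIMSEQ_SUP by simp
  define h where "h n = (\<lambda>i. indicator (hits u (G n)) i :: real)" for n
  have "\<forall>n. h n \<in> PiE UNIV (\<lambda>_::nat. {0, 1::real})"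
    by (simp add: h_def indicator_def PiE_iff)
  from convergent_binary_subsequence[OF this] obtain l r
    where l: "l \<in> PiE UNIV (\<lambda>_::nat. {0, 1::real})" and r: "strict_mono r"
      and lim: "\<And>i. (\<lambda>n. h (r n) i) \<longlonglongrightarrow> l i" by blast
  define S where "S = {i. l i = 1}"
  have ev: "\<forall>\<^sub>F n in sequentially. i \<in> hits u (G (r n)) \<longleftrightarrow> i \<in> S" for i
  proof -
    from lim have "\<forall>\<^sub>F n in sequentially. dist (h (r n) i) (l i) < 1"
      by (rule tendstoD) simp
    moreover have "l i = 0 \<or> l i = 1" using l by (auto simp: PiE_iff)
    ultimately show ?thesis
      by (elim eventually_mono) (auto simp: S_def h_def indicator_def dist_real_def split: if_splits)
  qed
  have "collectable u S"
    unfolding collectable_def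
  proof (intro conjI ballI)
    fix i j assume ij: "i \<in> S" "j \<in> S"
    obtain n where "i \<in> hits u (G (r n))" "j \<in> hits u (G (r n))"
      using eventually_happens'[OF sequentially_bot eventually_conj[OF ev[of i] ev[of j]]] ij by auto
    with collectable_hits[OF G(1)[of "r n"], of u]
    show "timelike (u i) (u j)" "u i \<in> triangle" by (auto simp: collectable_def)
  qed
  then obtain \<gamma> where \<gamma>: "\<gamma> \<in> paths" "S \<subseteq> hits u \<gamma>" using collectable_imp_path by blast
  have "best w u \<le> mass w S + ennreal e" if e: "0 < e" for e
  proof -
    obtain N where N: "\<And>S. collectable u S \<Longrightarrow> mass w (S \<inter> {N..}) \<le> ennreal e"
      using tail[OF e] by auto
    have "\<forall>\<^sub>F n in sequentially. \<forall>i\<in>{..<N}. i \<in> hits u (G (r n)) \<longleftrightarrow> i \<in> S"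
      by (intro eventually_ball_finite ballI ev) auto
    then have "\<forall>\<^sub>F n in sequentially. f (r n) \<le> mass w S + ennreal e"
    proof eventually_elim
      case (elim n)
      have "f (r n) = mass w (hits u (G (r n)) \<inter> {..<N}) + mass w (hits u (G (r n)) \<inter> {N..})"
        by (simp add: G(2) split[symmetric])
      also have "\<dots> \<le> mass w S + ennreal e"
        using elim by (intro add_mono N mass_mono collectable_hits G) auto
      finally show ?case .
    qed
    moreover have "(\<lambda>n. f (r n)) \<longlonglongrightarrow> best w u"
      using LIMSEQ_subseq_LIMSEQ[OF flim r] by (simp add: o_def)
    ultimately show ?thesis
      by (intro tendsto_upperbound) auto
  qed
  then have "best w u \<le> mass w S"
    by (rule ennreal_le_epsilon)
  also have "\<dots> \<le> mass w (hits u \<gamma>)" using \<gamma> by (intro mass_mono)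
  finally show "\<exists>\<gamma>\<in>paths. mass w (hits u \<gamma>) = best w u"
    using \<gamma>(1) mass_le_best[OF collectable_hits[OF \<gamma>(1)]] by (auto intro!: bexI[of _ \<gamma>] antisym)
qed

section \<open>Uniqueness in the absence of ties\<close>

text \<open>
  A point strictly between the two paths is compatible with every commonly collected point \<open>(y, r)\<close>:
  the upper path bounds its position from above by \<open>y + \<bar>s - r\<bar>\<close>, the lower path from below by
  \<open>y - \<bar>s - r\<bar>\<close>. So it can be added to the optimal set.
\<close>

lemma path_gap_contradicts_optimality:
  assumes \<gamma>: "\<gamma> \<in> paths" "\<gamma>' \<in> paths" and same: "hits u \<gamma> = hits u \<gamma>'"
    and opt: "mass w (hits u \<gamma>) = best w u" and fin: "best w u < \<infinity>"
    and dense: "\<And>R. open R \<Longrightarrow> R \<noteq> {} \<Longrightarrow> R \<subseteq> triangle \<Longrightarrow> \<exists>i. 0 < w i \<and> u i \<in> R"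
    and t: "t \<in> {0..1}" "\<gamma> t < \<gamma>' t"
  shows False
proof -
  have lip: "\<bar>\<gamma> r - \<gamma> s\<bar> \<le> \<bar>r - s\<bar>" "\<bar>\<gamma>' r - \<gamma>' s\<bar> \<le> \<bar>r - s\<bar>"
    if "r \<in> {0..1}" "s \<in> {0..1}" for r s
    using \<gamma> that by (simp_all add: paths_def)
  have "\<gamma> 1 = \<gamma>' 1" using \<gamma> by (simp add: paths_def)
  with t have "t < 1" by (cases "t = 1") auto
  \<comment> \<open>A box with centre half way between the paths, shifted slightly into the future of \<open>t\<close> (as \<open>t\<close> may
    be \<open>0\<close>). During time \<open>2 * \<delta> \<le> d / 4\<close> each path moves by less than \<open>d / 4\<close>, so the
    box of half width \<open>d / 8\<close> stays between them.\<close>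
  define d where "d = \<gamma>' t - \<gamma> t"
  define m where "m = (\<gamma> t + \<gamma>' t) / 2"
  define \<delta> where "\<delta> = min (d / 8) ((1 - t) / 2)"
  have "\<delta> \<le> d / 8" unfolding \<delta>_def by (rule min.cobounded1)
  moreover have "\<delta> \<le> (1 - t) / 2" unfolding \<delta>_def by (rule min.cobounded2)
  ultimately have d: "0 < d" "0 < \<delta>" "\<delta> \<le> d / 8" "t + 2 * \<delta> \<le> 1"
    using t \<open>t < 1\<close> by (simp_all add: d_def \<delta>_def)
  define R where "R = {m - d / 8<..<m + d / 8} \<times> {t<..<t + 2 * \<delta>}"
  have between: "0 \<le> s" "s \<le> 1" "\<gamma> s < x" "x < \<gamma>' s" if "(x, s) \<in> R" for x s
  proof -
    from that have xs: "m - d / 8 < x" "x < m + d / 8" "t < s" "s < t + 2 * \<delta>"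
      by (auto simp: R_def)
    then show s: "0 \<le> s" "s \<le> 1" using t d by auto
    have "\<bar>\<gamma> s - \<gamma> t\<bar> \<le> s - t" "\<bar>\<gamma>' s - \<gamma>' t\<bar> \<le> s - t"
      using lip[of s t] s t xs by auto
    moreover have "m = \<gamma> t + d / 2" "m = \<gamma>' t - d / 2"
      by (simp_all add: m_def d_def field_simps)
    ultimately show "\<gamma> s < x" "x < \<gamma>' s"
      using xs d by linarith+
  qed
  have Rtri: "R \<subseteq> triangle"
  proof
    fix p assume "p \<in> R"
    then have "(fst p, snd p) \<in> R" by simp
    from between[OF this] path_in_triangle[OF \<gamma>(1), of "snd p"] path_in_triangle[OF \<gamma>(2), of "snd p"]
    show "p \<in> triangle" by (auto simp: triangle_def case_prod_beta)
  qed
  have "(m, t + \<delta>) \<in> R" using d by (auto simp: R_def)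
  then have "R \<noteq> {}" by blast
  moreover have "open R" by (simp add: R_def open_Times)
  ultimately obtain i where i: "0 < w i" "u i \<in> R"
    using dense[of R] Rtri by blast
  obtain x s where xs: "u i = (x, s)" by (cases "u i")
  note b = between[OF i(2)[unfolded xs]]
  have "i \<notin> hits u \<gamma>" using b xs by (auto simp: hits_def mem_path_graph)
  have tl: "timelike (u i) (u j)" if "j \<in> hits u \<gamma>" for j
  proof -
    obtain y r where yr: "u j = (y, r)" by (cases "u j")
    have "r \<in> {0..1}" "y = \<gamma> r" "y = \<gamma>' r"
      using that same that[unfolded same] yr by (auto simp: hits_def mem_path_graph)
    with lip[of s r] b show ?thesis
      unfolding timelike_def xs yr by auto
  qed
  have "collectable u (insert i (hits u \<gamma>))"
    using collectable_hits[OF \<gamma>(1), of u] tl tl[THEN timelike_commute[THEN iffD1]] Rtri i(2)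
    by (auto simp: collectable_def) (simp add: timelike_def)
  from mass_le_best[OF this, of w] have "ennreal (w i) + best w u \<le> best w u"
    using \<open>i \<notin> hits u \<gamma>\<close> by (simp add: mass_insert opt)
  with fin i(1) show False
    by (cases "best w u") (auto simp: ennreal_plus[symmetric] simp del: ennreal_plus)
qed

text \<open>
  The largest mass that can be collected in addition to \<open>i\<close>, not counting the weight of \<open>i\<close> itself. In
  this form it does not depend on \<open>w i\<close>, and neither does the next quantity.
\<close>

definition best_through :: "nat \<Rightarrow> (nat \<Rightarrow> real) \<Rightarrow> (nat \<Rightarrow> real \<times> real) \<Rightarrow> ennreal" where
  "best_through i w u = (SUP F\<in>{F. finite F \<and> i \<notin> F \<and> collectable u (insert i F)}. mass w F)"

definition best_avoiding :: "nat \<Rightarrow> (nat \<Rightarrow> real) \<Rightarrow> (nat \<Rightarrow> real \<times> real) \<Rightarrow> ennreal" where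
  "best_avoiding i w u = (SUP F\<in>{F. finite F \<and> i \<notin> F \<and> collectable u F}. mass w F)"

lemma mass_cong_finite: "finite F \<Longrightarrow> (\<And>j. j \<in> F \<Longrightarrow> w j = w' j) \<Longrightarrow> mass w F = mass w' F"
  by (simp add: mass_finite)

lemma best_through_upd: "best_through i (w(i := c)) u = best_through i w u"
  unfolding best_through_def by (intro SUP_cong refl mass_cong_finite) auto

lemma best_avoiding_upd: "best_avoiding i (w(i := c)) u = best_avoiding i w u"
  unfolding best_avoiding_def by (intro SUP_cong refl mass_cong_finite) auto

lemma mass_le_best_through:
  assumes "i \<notin> S" "collectable u (insert i S)"
  shows "mass w S \<le> best_through i w u"
  unfolding best_through_def
  by (subst mass_SUP_finite, rule SUP_least, rule SUP_upper)
     (use assms in \<open>auto intro: collectable_mono\<close>)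

lemma mass_le_best_avoiding:
  assumes "i \<notin> S" "collectable u S"
  shows "mass w S \<le> best_avoiding i w u"
  unfolding best_avoiding_def
  by (subst mass_SUP_finite, rule SUP_least, rule SUP_upper)
     (use assms in \<open>auto intro: collectable_mono\<close>)

text \<open>
  Both optimal values are computed twice: the maximum is \<open>w i\<close> plus the best complement of \<open>i\<close>, and it
  is also the best value without \<open>i\<close>. Finiteness allows the equation to be solved for \<open>w i\<close>.
\<close>

lemma tie_equation:
  assumes \<gamma>: "\<gamma> \<in> paths" "\<gamma>' \<in> paths" and fin: "best w u < \<infinity>" and nonneg: "0 \<le> w i"
    and opt: "mass w (hits u \<gamma>) = best w u" "mass w (hits u \<gamma>') = best w u"
    and i: "i \<in> hits u \<gamma>" "i \<notin> hits u \<gamma>'"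
  shows "w i = enn2real (best_avoiding i w u) - enn2real (best_through i w u)"
proof -
  have ins: "insert i (hits u \<gamma> - {i}) = hits u \<gamma>" using i by auto
  then have eq: "best w u = ennreal (w i) + mass w (hits u \<gamma> - {i})"
    using mass_insert[of i "hits u \<gamma> - {i}" w] opt(1) by simp
  have "best_through i w u = mass w (hits u \<gamma> - {i})"
  proof (rule antisym)
    show "best_through i w u \<le> mass w (hits u \<gamma> - {i})"
      unfolding best_through_def
    proof (rule SUP_least)
      fix F assume F: "F \<in> {F. finite F \<and> i \<notin> F \<and> collectable u (insert i F)}"
      then have "ennreal (w i) + mass w F \<le> best w u"
        using mass_le_best[of u "insert i F" w] by (simp add: mass_insert)
      then show "mass w F \<le> mass w (hits u \<gamma> - {i})"
        unfolding eq by (simp add: ennreal_add_left_cancel_le)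
    qed
    show "mass w (hits u \<gamma> - {i}) \<le> best_through i w u"
      using collectable_hits[OF \<gamma>(1), of u] by (intro mass_le_best_through) (simp, simp only: ins)
  qed
  moreover have "best_avoiding i w u = best w u"
  proof (rule antisym)
    show "best_avoiding i w u \<le> best w u"
      unfolding best_avoiding_def by (rule SUP_least) (simp add: mass_le_best)
    show "best w u \<le> best_avoiding i w u"
      unfolding opt(2)[symmetric] using i(2) by (intro mass_le_best_avoiding collectable_hits \<gamma>)
  qed
  ultimately have *: "best_avoiding i w u = ennreal (w i) + best_through i w u"
    "best_avoiding i w u < \<infinity>"
    using eq fin by auto
  then have "best_through i w u < \<infinity>"
    by (cases "best_through i w u") auto
  with * nonneg show ?thesis
    by (simp add: enn2real_plus)
qed

lemma optimal_path_unique: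
  assumes fin: "best w u < \<infinity>" and nonneg: "\<And>i. 0 \<le> w i"
    and dense: "\<And>R. open R \<Longrightarrow> R \<noteq> {} \<Longrightarrow> R \<subseteq> triangle \<Longrightarrow> \<exists>i. 0 < w i \<and> u i \<in> R"
    and no_tie: "\<And>i. w i \<noteq> enn2real (best_avoiding i w u) - enn2real (best_through i w u)"
    and \<gamma>: "\<gamma> \<in> paths" "mass w (hits u \<gamma>) = best w u"
    and \<gamma>': "\<gamma>' \<in> paths" "mass w (hits u \<gamma>') = best w u"
  shows "\<gamma> = \<gamma>'"
proof -
  have same: "hits u \<gamma> = hits u \<gamma>'"
    using tie_equation[OF \<gamma>(1) \<gamma>'(1) fin nonneg \<gamma>(2) \<gamma>'(2)]
      tie_equation[OF \<gamma>'(1) \<gamma>(1) fin nonneg \<gamma>'(2) \<gamma>(2)] no_tie by blast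
  have "\<gamma> t = \<gamma>' t" if "t \<in> {0..1}" for t
    using path_gap_contradicts_optimality[OF \<gamma>(1) \<gamma>'(1) same \<gamma>(2) fin dense that]
      path_gap_contradicts_optimality[OF \<gamma>'(1) \<gamma>(1) same[symmetric] \<gamma>'(2) fin dense that]
    by (cases "\<gamma> t" "\<gamma>' t" rule: linorder_cases) auto
  moreover have "\<gamma> \<in> extensional {0..1}" "\<gamma>' \<in> extensional {0..1}"
    using \<gamma>(1) \<gamma>'(1) by (auto simp: paths_def)
  ultimately show ?thesis by (intro extensionalityI)
qed

section \<open>Measurability\<close>

lemma measurable_collectable:
  assumes F: "finite F" and u: "\<And>i. (\<lambda>\<omega>. u \<omega> i) \<in> N \<rightarrow>\<^sub>M (borel :: (real \<times> real) measure)"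
  shows "Measurable.pred N (\<lambda>\<omega>. collectable (u \<omega>) F)"
proof -
  have [measurable]: "Measurable.pred N (\<lambda>\<omega>. u \<omega> i \<in> triangle)" for i
    by (rule pred_sets2[OF triangle_sets u])
  have [measurable]: "(\<lambda>\<omega>. fst (u \<omega> i)) \<in> borel_measurable N"
      "(\<lambda>\<omega>. snd (u \<omega> i)) \<in> borel_measurable N" for i
    by (rule measurable_compose[OF u borel_measurable_continuous_onI];
        intro continuous_intros)+
  have "Measurable.pred N (\<lambda>\<omega>. timelike (u \<omega> i) (u \<omega> j))" for i j
    unfolding timelike_def by measurable
  then show ?thesis
    unfolding collectable_def by (intro pred_intros_logic pred_intros_finite F) auto
qed

lemma measurable_SUP_mass:
  fixes w :: "'b \<Rightarrow> nat \<Rightarrow> real"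
  assumes [measurable]: "\<And>i. (\<lambda>\<omega>. w \<omega> i) \<in> borel_measurable N"
    and [measurable]: "\<And>F. finite F \<Longrightarrow> Measurable.pred N (\<lambda>\<omega>. P \<omega> F)"
  shows "(\<lambda>\<omega>. SUP F\<in>{F. finite F \<and> P \<omega> F}. mass (w \<omega>) F) \<in> borel_measurable N"
proof -
  have "(SUP F\<in>{F. finite F \<and> P \<omega> F}. mass (w \<omega>) F) =
      (SUP F\<in>Collect finite. if P \<omega> F then (\<Sum>i\<in>F. ennreal (w \<omega> i)) else 0)" for \<omega>
  proof (rule antisym; rule SUP_least)
    fix F assume F: "F \<in> {F. finite F \<and> P \<omega> F}"
    then have "mass (w \<omega>) F = (if P \<omega> F then (\<Sum>i\<in>F. ennreal (w \<omega> i)) else 0)"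
      by (simp add: mass_finite)
    also have "\<dots> \<le> (SUP F\<in>Collect finite. if P \<omega> F then (\<Sum>i\<in>F. ennreal (w \<omega> i)) else 0)"
      using F by (intro SUP_upper) simp
    finally show "mass (w \<omega>) F \<le> \<dots>" .
  next
    fix F :: "nat set" assume "F \<in> Collect finite"
    then show "(if P \<omega> F then (\<Sum>i\<in>F. ennreal (w \<omega> i)) else 0) \<le> (SUP F\<in>{F. finite F \<and> P \<omega> F}. mass (w \<omega>) F)"
      by (auto simp: mass_finite[symmetric] intro!: SUP_upper)
  qed
  moreover have "(\<lambda>\<omega>. SUP F\<in>Collect finite. if P \<omega> F then (\<Sum>i\<in>F. ennreal (w \<omega> i)) else 0) \<in> borel_measurable N"
    by (rule borel_measurable_SUP) (auto simp: countable_Collect_finite)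
  ultimately show ?thesis by simp
qed

context
  fixes N :: "'b measure" and w :: "'b \<Rightarrow> nat \<Rightarrow> real" and u :: "'b \<Rightarrow> nat \<Rightarrow> real \<times> real"
  assumes w: "\<And>i. (\<lambda>\<omega>. w \<omega> i) \<in> borel_measurable N"
    and u: "\<And>i. (\<lambda>\<omega>. u \<omega> i) \<in> N \<rightarrow>\<^sub>M borel"
begin

lemma measurable_best: "(\<lambda>\<omega>. best (w \<omega>) (u \<omega>)) \<in> borel_measurable N"
  unfolding best_eq_SUP_finite using w measurable_collectable[OF _ u]
  by (rule measurable_SUP_mass)

lemma measurable_best_through: "(\<lambda>\<omega>. best_through i (w \<omega>) (u \<omega>)) \<in> borel_measurable N"
  unfolding best_through_def using w
  by (rule measurable_SUP_mass) (intro pred_intros_logic measurable_collectable[OF _ u], auto)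

lemma measurable_best_avoiding: "(\<lambda>\<omega>. best_avoiding i (w \<omega>) (u \<omega>)) \<in> borel_measurable N"
  unfolding best_avoiding_def using w
  by (rule measurable_SUP_mass) (intro pred_intros_logic measurable_collectable[OF _ u], auto)

end

section \<open>Long chains of uniform points\<close>

definition past :: "real \<times> real \<Rightarrow> (real \<times> real) set" where
  "past p = {q. 0 \<le> snd q \<and> snd q \<le> snd p \<and> \<bar>fst q - fst p\<bar> \<le> snd p - snd q}"

text \<open>
  The chain condition in the form in which it can be integrated one point at a time: each point lies in
  the backward cone of its predecessor, starting from \<open>p\<close>.
\<close>

primrec descends :: "('i \<Rightarrow> real \<times> real) \<Rightarrow> real \<times> real \<Rightarrow> 'i list \<Rightarrow> bool" where
  "descends u p [] \<longleftrightarrow> True"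
| "descends u p (i # is) \<longleftrightarrow> u i \<in> past p \<and> descends u (u i) is"

lemma triangle_eq_past: "triangle = past (0, 1)"
  by (auto simp: triangle_def past_def)

text \<open>
  Listing the points by decreasing time turns a compatible set into a descending chain.
\<close>

lemma collectable_imp_descends:
  assumes "finite F" "collectable u F" "\<And>i. i \<in> F \<Longrightarrow> u i \<in> past p"
  shows "\<exists>is. distinct is \<and> set is = F \<and> descends u p is"
  using assms
proof (induction F arbitrary: p rule: finite_ranking_induct[where f="\<lambda>i. snd (u i)"])
  case empty
  then show ?case by (intro exI[of _ "[]"]) simp
next
  case (insert i S)
  show ?case
  proof (cases "i \<in> S")
    case True
    with insert have "\<exists>is. distinct is \<and> set is = S \<and> descends u p is"
      by (simp add: insert_absorb)
    with True show ?thesis by (simp add: insert_absorb)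
  next
    case False
    have "u j \<in> past (u i)" if "j \<in> S" for j
      using insert.hyps(2)[OF that] insert.prems that
      by (auto simp: collectable_def timelike_def past_def)
    then obtain "is" where "distinct is" "set is = S" "descends u (u i) is"
      using insert.IH[of "u i"] insert.prems collectable_mono by blast
    with False insert.prems(2) show ?thesis
      by (intro exI[of _ "i # is"]) auto
  qed
qed

lemma measurable_descends:
  assumes "p \<in> N \<rightarrow>\<^sub>M (borel :: (real \<times> real) measure)"
    and "\<And>i. i \<in> set is \<Longrightarrow> (\<lambda>\<omega>. u \<omega> i) \<in> N \<rightarrow>\<^sub>M (borel :: (real \<times> real) measure)"
  shows "Measurable.pred N (\<lambda>\<omega>. descends (u \<omega>) (p \<omega>) is)"
  using assms
proof (induction "is" arbitrary: p)
  case (Cons i "is")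
  have fs: "(\<lambda>\<omega>. fst (f \<omega>)) \<in> borel_measurable N" "(\<lambda>\<omega>. snd (f \<omega>)) \<in> borel_measurable N"
    if "f \<in> N \<rightarrow>\<^sub>M (borel :: (real \<times> real) measure)" for f
    by (rule measurable_compose[OF that borel_measurable_continuous_onI]; intro continuous_intros)+
  have ui: "(\<lambda>\<omega>. u \<omega> i) \<in> N \<rightarrow>\<^sub>M borel" using Cons.prems(2) by simp
  note [measurable] = fs[OF Cons.prems(1)] fs[OF ui]
  have "Measurable.pred N (\<lambda>\<omega>. u \<omega> i \<in> past (p \<omega>))"
    unfolding past_def mem_Collect_eq by measurable
  moreover have "Measurable.pred N (\<lambda>\<omega>. descends (u \<omega>) (u \<omega> i) is)"
    using Cons.prems(2) by (intro Cons.IH) auto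
  ultimately show ?case by simp
qed simp

text \<open>
  At time \<open>s\<close> the backward cone of \<open>(x, t)\<close> has width \<open>2 * (t - s)\<close>.
\<close>

lemma nn_integral_past:
  assumes [measurable]: "h \<in> borel_measurable borel"
  shows "(\<integral>\<^sup>+q. indicator (past (x, t)) q * h (snd q) \<partial>lborel) =
    (\<integral>\<^sup>+s. ennreal (2 * (t - s)) * indicator {0..t} s * h s \<partial>lborel)"
proof -
  have meas: "(\<lambda>q. indicator (past (x, t)) q * h (snd q)) \<in> borel_measurable (lborel \<Otimes>\<^sub>M lborel)"
    unfolding past_def by measurable
  have "(\<integral>\<^sup>+q. indicator (past (x, t)) q * h (snd q) \<partial>lborel) =
      (\<integral>\<^sup>+q. indicator (past (x, t)) q * h (snd q) \<partial>(lborel \<Otimes>\<^sub>M lborel))"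
    by (simp add: lborel_prod)
  also have "\<dots> = (\<integral>\<^sup>+s. \<integral>\<^sup>+y. indicator (past (x, t)) (y, s) * h s \<partial>lborel \<partial>lborel)"
    using lborel_pair.nn_integral_snd[OF meas] by simp
  also have "\<dots> = (\<integral>\<^sup>+s. ennreal (2 * (t - s)) * indicator {0..t} s * h s \<partial>lborel)"
  proof (rule nn_integral_cong)
    fix s :: real
    have "(\<integral>\<^sup>+y. indicator (past (x, t)) (y, s) * h s \<partial>lborel) =
        (\<integral>\<^sup>+y. (indicator {0..t} s * h s) * indicator {x - (t - s)..x + (t - s)} y \<partial>lborel)"
      by (intro nn_integral_cong) (auto simp: indicator_def past_def)
    also have "\<dots> = ennreal (2 * (t - s)) * indicator {0..t} s * h s"
      by (subst nn_integral_cmult_indicator) (auto simp: indicator_def ac_simps)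
    finally show "(\<integral>\<^sup>+y. indicator (past (x, t)) (y, s) * h s \<partial>lborel) =
      ennreal (2 * (t - s)) * indicator {0..t} s * h s" .
  qed
  finally show ?thesis .
qed

text \<open>
  The volume of the set of descending chains of length \<open>k\<close> below a point at time \<open>t\<close>: the recursion
  \<open>V (k + 1) t\<close> = integral over \<open>s\<close> from \<open>0\<close> to \<open>t\<close> of \<open>2 * (t - s) * V k s\<close>, with \<open>V 0 = 1\<close>, has this
  solution.
\<close>

definition chain_volume :: "nat \<Rightarrow> real \<Rightarrow> real" where
  "chain_volume k t = 2 ^ k * t ^ (2 * k) / fact (2 * k)"

lemma nn_integral_chain_volume:
  assumes "0 \<le> t"
  shows "(\<integral>\<^sup>+q. indicator (past (x, t)) q * ennreal (chain_volume k (snd q)) \<partial>lborel) =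
    ennreal (chain_volume (Suc k) t)"
proof -
  define c :: real where "c = 2 ^ Suc k / fact (2 * k)"
  define G where "G s = c * (t * (s ^ Suc (2 * k) / Suc (2 * k)) - s ^ Suc (Suc (2 * k)) / Suc (Suc (2 * k)))" for s :: real
  have pow: "((\<lambda>s. s ^ Suc n / Suc n) has_real_derivative s ^ n) (at s)" for n and s :: real
    by (auto intro!: derivative_eq_intros simp del: power_Suc)
  have "(G has_real_derivative c * (t * s ^ (2 * k) - s ^ Suc (2 * k))) (at s)" for s
    unfolding G_def by (intro DERIV_cmult DERIV_diff pow)
  moreover have "c * (t * s ^ (2 * k) - s ^ Suc (2 * k)) = 2 * (t - s) * chain_volume k s" for s
    by (simp add: c_def chain_volume_def right_diff_distrib left_diff_distrib diff_divide_distrib mult_ac)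
  ultimately have deriv: "(G has_real_derivative 2 * (t - s) * chain_volume k s) (at s)" for s
    by metis
  have "(\<integral>\<^sup>+q. indicator (past (x, t)) q * ennreal (chain_volume k (snd q)) \<partial>lborel) =
     (\<integral>\<^sup>+s. ennreal (2 * (t - s)) * indicator {0..t} s * ennreal (chain_volume k s) \<partial>lborel)"
    by (rule nn_integral_past) (simp add: chain_volume_def)
  also have "\<dots> = (\<integral>\<^sup>+s. ennreal (2 * (t - s) * chain_volume k s) * indicator {0..t} s \<partial>lborel)"
    by (intro nn_integral_cong)
       (auto simp: indicator_def chain_volume_def ennreal_mult[symmetric] simp del: ennreal_mult')
  also have "\<dots> = ennreal (G t - G 0)"
    using assms by (intro nn_integral_FTC_Icc DERIV_subset[OF deriv])
      (auto simp: chain_volume_def)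
  also have "G t - G 0 = c * t ^ (2 * Suc k) * (1 / Suc (2 * k) - 1 / Suc (Suc (2 * k)))"
    by (simp add: G_def right_diff_distrib)
  also have "1 / real (Suc (2 * k)) - 1 / real (Suc (Suc (2 * k))) = 1 / (Suc (2 * k) * Suc (Suc (2 * k)))"
    by (simp add: field_simps)
  also have "c * t ^ (2 * Suc k) * \<dots> = chain_volume (Suc k) t"
    by (simp add: c_def chain_volume_def mult_ac) (simp add: algebra_simps)
  finally show ?thesis by simp
qed

lemma emeasure_triangle: "emeasure lborel triangle = 1"
proof -
  have "emeasure lborel triangle = (\<integral>\<^sup>+q. indicator (past (0, 1)) q * ennreal (chain_volume 0 (snd q)) \<partial>lborel)"
    using closed_triangle by (simp add: chain_volume_def triangle_eq_past[symmetric])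
  then show ?thesis
    by (simp add: nn_integral_chain_volume) (simp add: chain_volume_def)
qed

lemma nn_integral_uniform_triangle_le:
  assumes "f \<in> borel_measurable borel"
  shows "(\<integral>\<^sup>+q. f q \<partial>uniform_measure lborel triangle) \<le> (\<integral>\<^sup>+q. f q \<partial>lborel)"
  using assms
  by (subst nn_integral_uniform_measure)
     (auto simp: emeasure_triangle indicator_def divide_ennreal_def intro!: nn_integral_mono)

lemma prob_space_uniform_triangle: "prob_space (uniform_measure lborel triangle)"
  by (rule prob_space_uniform_measure) (simp_all add: emeasure_triangle)

lemma descends_cong:
  "(\<And>i. i \<in> set is \<Longrightarrow> u i = v i) \<Longrightarrow> descends u p is = descends v p is"
  by (induction "is" arbitrary: p) auto

text \<open>
  Integrate out the first (latest) point last: given that point, the rest of the list has to descend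
  from it, which has probability at most \<open>chain_volume\<close> by induction. The triangle has area \<open>1\<close>, so the
  uniform density is bounded by \<open>1\<close>.
\<close>

lemma emeasure_descends_le:
  assumes "distinct is" "0 \<le> snd p"
  shows "emeasure (Pi\<^sub>M (set is) (\<lambda>_. uniform_measure lborel triangle))
      {w \<in> space (Pi\<^sub>M (set is) (\<lambda>_. uniform_measure lborel triangle)). descends w p is}
    \<le> ennreal (chain_volume (length is) (snd p))"
  using assms
proof (induction "is" arbitrary: p)
  case Nil
  show ?case
    by (simp add: chain_volume_def PiM_empty)
next
  case (Cons i "is")
  define \<mu> where "\<mu> = uniform_measure lborel triangle"
  interpret \<mu>: prob_space \<mu> unfolding \<mu>_def by (rule prob_space_uniform_triangle)
  interpret product_sigma_finite "\<lambda>_::'a. \<mu>" by standard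
  have sets_\<mu> [measurable_cong]: "sets \<mu> = sets borel" by (simp add: \<mu>_def)
  let ?P = "\<lambda>J. Pi\<^sub>M J (\<lambda>_. \<mu>)"
  have comp: "(\<lambda>w. w j) \<in> ?P J \<rightarrow>\<^sub>M borel" if "j \<in> J" for j :: 'a and J
    using measurable_component_singleton[OF that, of "\<lambda>_. \<mu>"]
    by (simp cong: measurable_cong_sets add: sets_\<mu>)
  have pred: "Measurable.pred (?P J) (\<lambda>w. descends w q js)" if "set js \<subseteq> J" for J js q
    using that by (intro measurable_descends comp) auto
  have "emeasure (?P (set (i # is))) {w \<in> space (?P (set (i # is))). descends w p (i # is)} =
      (\<integral>\<^sup>+w. indicator {w \<in> space (?P (insert i (set is))). descends w p (i # is)} w \<partial>?P (insert i (set is)))"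
    using pred[of "i # is" "insert i (set is)" p] by (subst nn_integral_indicator) (auto simp: pred_def)
  also have "\<dots> = (\<integral>\<^sup>+y. (\<integral>\<^sup>+x. indicator {w \<in> space (?P (insert i (set is))). descends w p (i # is)} (x(i := y)) \<partial>?P (set is)) \<partial>\<mu>)"
    using Cons.prems pred[of "i # is" "insert i (set is)" p]
    by (intro product_nn_integral_insert_rev) (auto simp: pred_def)
  also have "\<dots> = (\<integral>\<^sup>+y. indicator (past p) y * emeasure (?P (set is)) {w \<in> space (?P (set is)). descends w y is} \<partial>\<mu>)"
  proof (rule nn_integral_cong)
    fix y assume "y \<in> space \<mu>"
    have "(\<integral>\<^sup>+x. indicator {w \<in> space (?P (insert i (set is))). descends w p (i # is)} (x(i := y)) \<partial>?P (set is)) =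
        (\<integral>\<^sup>+x. indicator (past p) y * indicator {w \<in> space (?P (set is)). descends w y is} x \<partial>?P (set is))"
    proof (rule nn_integral_cong)
      fix x assume x: "x \<in> space (?P (set is))"
      then have "x(i := y) \<in> space (?P (insert i (set is)))"
        using \<open>y \<in> space \<mu>\<close> by (auto simp: space_PiM PiE_iff extensional_def)
      moreover have "descends (x(i := y)) y is = descends x y is"
        using Cons.prems by (intro descends_cong) auto
      ultimately show "(indicator {w \<in> space (?P (insert i (set is))). descends w p (i # is)} (x(i := y)) :: ennreal) =
          indicator (past p) y * indicator {w \<in> space (?P (set is)). descends w y is} x"
        using x by (auto simp: indicator_def)
    qed
    also have "\<dots> = indicator (past p) y * emeasure (?P (set is)) {w \<in> space (?P (set is)). descends w y is}"
      using pred[of "is" "set is" y] by (subst nn_integral_cmult_indicator) (auto simp: pred_def)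
    finally show "(\<integral>\<^sup>+x. indicator {w \<in> space (?P (insert i (set is))). descends w p (i # is)} (x(i := y)) \<partial>?P (set is)) = \<dots>" .
  qed
  also have "\<dots> \<le> (\<integral>\<^sup>+y. indicator (past p) y * ennreal (chain_volume (length is) (snd y)) \<partial>\<mu>)"
    using Cons.IH Cons.prems
    by (intro nn_integral_mono) (auto simp: indicator_def \<mu>_def past_def)
  also have "\<dots> \<le> (\<integral>\<^sup>+y. indicator (past p) y * ennreal (chain_volume (length is) (snd y)) \<partial>lborel)"
    unfolding \<mu>_def
  proof (rule nn_integral_uniform_triangle_le)
    show "(\<lambda>y. indicator (past p) y * ennreal (chain_volume (length is) (snd y))) \<in> borel_measurable borel"
      unfolding past_def chain_volume_def borel_prod[symmetric] by measurable
  qed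
  also have "\<dots> = ennreal (chain_volume (length (i # is)) (snd p))"
    using nn_integral_chain_volume[OF Cons.prems(2), of "fst p" "length is"] by simp
  finally show ?case by (simp add: \<mu>_def)
qed

lemma (in prob_space) prob_descends_le:
  assumes iid: "iid_uniform_triangle M U" and "is": "distinct is"
  shows "prob {\<omega> \<in> space M. descends (\<lambda>i. U i \<omega>) (0, 1) is} \<le> 2 ^ length is / fact (2 * length is)"
proof (cases "is = []")
  case True
  then show ?thesis by (simp add: prob_space)
next
  case False
  define \<mu> where "\<mu> = uniform_measure lborel triangle"
  have ind: "indep_vars (\<lambda>_. borel) U UNIV" and law: "distr M borel (U i) = \<mu>" for i
    using iid by (auto simp: iid_uniform_triangle_def \<mu>_def)
  have U: "random_variable borel (U i)" for i
    using ind by (auto simp: indep_vars_def)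
  have "indep_vars (\<lambda>_. borel) U (set is)" using ind by (rule indep_vars_subset) simp
  then have joint: "distr M (Pi\<^sub>M (set is) (\<lambda>_. borel)) (\<lambda>\<omega>. \<lambda>i\<in>set is. U i \<omega>) = Pi\<^sub>M (set is) (\<lambda>_. \<mu>)"
    using False U by (subst (asm) indep_vars_iff_distr_eq_PiM) (auto simp: law)
  have sets_eq: "sets (Pi\<^sub>M (set is) (\<lambda>_. \<mu>)) = sets (Pi\<^sub>M (set is) (\<lambda>_. borel))"
    by (simp add: joint[symmetric])
  define A where "A = {w \<in> space (Pi\<^sub>M (set is) (\<lambda>_. borel)). descends w (0, 1) is}"
  have "Measurable.pred (Pi\<^sub>M (set is) (\<lambda>_. borel)) (\<lambda>w. descends w (0, 1) is)"
    by (intro measurable_descends) auto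
  then have A: "A \<in> sets (Pi\<^sub>M (set is) (\<lambda>_. borel))" by (simp add: A_def pred_def)
  have "emeasure M {\<omega> \<in> space M. descends (\<lambda>i. U i \<omega>) (0, 1) is} =
      emeasure M ((\<lambda>\<omega>. \<lambda>i\<in>set is. U i \<omega>) -` A \<inter> space M)"
    by (intro arg_cong[where f="emeasure M"])
       (auto simp: A_def space_PiM cong: descends_cong)
  also have "\<dots> = emeasure (Pi\<^sub>M (set is) (\<lambda>_. \<mu>)) A"
    unfolding joint[symmetric] using A U by (subst emeasure_distr) auto
  also have "\<dots> \<le> ennreal (chain_volume (length is) (snd (0::real, 1)))"
    using emeasure_descends_le[OF "is", of "(0,1)"]
    by (simp add: A_def \<mu>_def[symmetric] sets_eq_imp_space_eq[OF sets_eq])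
  finally show ?thesis
    by (simp add: chain_volume_def emeasure_eq_measure)
qed

text \<open>
  Union bound over the at most \<open>n ^ k\<close> ordered lists of \<open>k\<close> distinct indices below \<open>n\<close>.
\<close>

lemma (in prob_space) prob_long_chain_le:
  assumes iid: "iid_uniform_triangle M U"
  defines "L \<equiv> \<lambda>n k. {\<omega> \<in> space M. \<exists>F\<subseteq>{..<n}. card F = k \<and> collectable (\<lambda>i. U i \<omega>) F}"
  shows "L n k \<in> events" and "prob (L n k) \<le> real n ^ k * 2 ^ k / fact (2 * k)"
proof -
  have U: "random_variable borel (U i)" for i
    using iid by (auto simp: iid_uniform_triangle_def indep_vars_def)
  have fin: "finite F" if "F \<subseteq> {..<n}" for F :: "nat set"
    using that finite_subset by blast
  have "L n k = (\<Union>F\<in>{F. F \<subseteq> {..<n} \<and> card F = k}. {\<omega> \<in> space M. collectable (\<lambda>i. U i \<omega>) F})"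
    by (auto simp: L_def)
  also have "\<dots> \<in> events"
  proof (intro sets.finite_UN)
    show "finite {F. F \<subseteq> {..<n} \<and> card F = k}"
      by (rule finite_subset[of _ "Pow {..<n}"]) auto
    show "{\<omega> \<in> space M. collectable (\<lambda>i. U i \<omega>) F} \<in> events" if "F \<in> {F. F \<subseteq> {..<n} \<and> card F = k}" for F
      using measurable_collectable[OF fin, of F "\<lambda>\<omega> i. U i \<omega>" M] that U by (simp add: pred_def)
  qed
  finally show Lev: "L n k \<in> events" .
  define J where "J = {is. distinct is \<and> set is \<subseteq> {..<n} \<and> length is = k}"
  have Jsub: "J \<subseteq> {is. set is \<subseteq> {..<n} \<and> length is = k}" by (auto simp: J_def)
  have finJ: "finite J" by (rule finite_subset[OF Jsub]) (rule finite_lists_length_eq, simp)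
  have cardJ: "card J \<le> n ^ k"
    using card_mono[OF finite_lists_length_eq[of "{..<n}" k] Jsub]
    by (simp add: card_lists_length_eq)
  let ?D = "\<lambda>is. {\<omega> \<in> space M. descends (\<lambda>i. U i \<omega>) (0, 1) is}"
  have D: "?D is \<in> events" for "is"
    using measurable_descends[of "\<lambda>_. (0,1)" M "is" "\<lambda>\<omega> i. U i \<omega>"] U by (simp add: pred_def)
  have "L n k \<subseteq> (\<Union>is\<in>J. ?D is)"
  proof
    fix \<omega> assume "\<omega> \<in> L n k"
    then obtain F where \<omega>: "\<omega> \<in> space M" and F: "F \<subseteq> {..<n}" "card F = k" "collectable (\<lambda>i. U i \<omega>) F"
      by (auto simp: L_def)
    have "U i \<omega> \<in> past (0, 1)" if "i \<in> F" for i
      using F(3) that by (simp add: collectable_def triangle_eq_past)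
    from collectable_imp_descends[OF fin[OF F(1)] F(3) this]
    obtain "is" where "is": "distinct is" "set is = F" "descends (\<lambda>i. U i \<omega>) (0, 1) is" by blast
    then have "length is = k" using F(2) distinct_card[of "is"] by simp
    with "is" F(1) \<omega> show "\<omega> \<in> (\<Union>is\<in>J. ?D is)" by (auto simp: J_def)
  qed
  then have "prob (L n k) \<le> prob (\<Union>is\<in>J. ?D is)"
    using finJ D by (intro finite_measure_mono sets.finite_UN) auto
  also have "\<dots> \<le> (\<Sum>is\<in>J. prob (?D is))"
    using D finJ by (intro finite_measure_subadditive_finite) auto
  also have "\<dots> \<le> (\<Sum>is\<in>J. 2 ^ k / fact (2 * k))"
    using prob_descends_le[OF iid] by (intro sum_mono) (auto simp: J_def)
  also have "\<dots> = real (card J) * (2 ^ k / fact (2 * k))" by simp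
  also have "\<dots> \<le> real n ^ k * (2 ^ k / fact (2 * k))"
    using of_nat_mono[OF cardJ, where 'a=real] by (intro mult_right_mono) simp_all
  finally show "prob (L n k) \<le> real n ^ k * 2 ^ k / fact (2 * k)" by simp
qed

lemma power_over_fact_le_exp: "x ^ n / fact n \<le> exp x" if "0 \<le> x" for x :: real
proof -
  have s: "(\<lambda>k. x ^ k / fact k) sums exp x"
    using exp_converges[of x] by (simp add: scaleR_conv_of_real divide_inverse mult.commute)
  have "(\<Sum>k\<in>{n}. x ^ k / fact k) \<le> (\<Sum>k. x ^ k / fact k)"
    using s that by (intro sum_le_suminf) (auto simp: sums_iff)
  with s show ?thesis by (simp add: sums_iff)
qed

text \<open>
  With \<open>n = 4 ^ m\<close> and \<open>k = 4 * sqrt n\<close>: from \<open>(2 * k) ^ (2 * k) / fact (2 * k) \<le> exp (2 * k) \<le> 9 ^ k\<close>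
  the left-hand side is at most \<open>(18 * n / (2 * k) ^ 2) ^ k = (9 / 32) ^ k\<close>. The factor \<open>4\<close> in \<open>k\<close>
  is chosen large enough for this base to be less than \<open>1 / 2\<close>.
\<close>

lemma chain_bound_geometric:
  defines "k \<equiv> \<lambda>m. 4 * 2 ^ m :: nat"
  shows "real (4 ^ m) ^ k m * 2 ^ k m / fact (2 * k m) \<le> (1 / 2) ^ m"
proof -
  define K where "K = k m"
  define x where "x = real (2 * K)"
  have "(2 ^ m) ^ 2 = (2 ^ 2 :: real) ^ m"
    by (simp only: power_mult[symmetric] mult.commute)
  then have x: "x > 0" "x ^ 2 = 64 * 4 ^ m"
    by (simp_all add: x_def K_def k_def power_mult_distrib)
  have "x ^ (2 * K) / fact (2 * K) \<le> exp x" using x by (intro power_over_fact_le_exp) simp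
  also have "exp x = exp 1 ^ (2 * K)" by (simp add: x_def exp_of_nat_mult[symmetric])
  also have "\<dots> \<le> 3 ^ (2 * K)" by (intro power_mono exp_le) simp
  also have "(3::real) ^ (2 * K) = 9 ^ K" by (simp only: power_mult) simp
  also have "x ^ (2 * K) = (64 * 4 ^ m) ^ K" by (simp only: power_mult x(2))
  finally have le: "(64 * 4 ^ m) ^ K / fact (2 * K) \<le> (9::real) ^ K" .
  have "real (4 ^ m) ^ K * 2 ^ K / fact (2 * K) = (1 / 32) ^ K * ((64 * 4 ^ m) ^ K / fact (2 * K))"
    by (simp only: times_divide_eq_right power_mult_distrib[symmetric]) simp
  also have "\<dots> \<le> (1 / 32) ^ K * 9 ^ K"
    using le by (intro mult_left_mono) simp_all
  also have "\<dots> = (9 / 32) ^ K" by (simp add: power_mult_distrib[symmetric])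
  also have "\<dots> \<le> (1 / 2) ^ K" by (intro power_mono) auto
  also have "\<dots> \<le> (1 / 2) ^ m"
  proof (rule power_decreasing)
    have "m < 2 ^ m" by (rule less_exp)
    then show "m \<le> K" unfolding K_def k_def by linarith
  qed auto
  finally show ?thesis by (simp add: K_def)
qed

lemma (in prob_space) AE_chains_short:
  assumes iid: "iid_uniform_triangle M U"
  shows "AE \<omega> in M. \<forall>\<^sub>F m in sequentially. \<forall>F. F \<subseteq> {..<4 ^ m} \<longrightarrow>
    collectable (\<lambda>i. U i \<omega>) F \<longrightarrow> card F \<le> 4 * 2 ^ m"
proof -
  define A where "A m = {\<omega> \<in> space M. \<exists>F\<subseteq>{..<4 ^ m}. card F = 4 * 2 ^ m \<and> collectable (\<lambda>i. U i \<omega>) F}" for m :: nat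
  have A: "A m \<in> events" "prob (A m) \<le> (1 / 2) ^ m" for m
    using prob_long_chain_le[OF iid, of "4 ^ m" "4 * 2 ^ m"] chain_bound_geometric[of m]
    by (auto simp: A_def)
  have "summable (\<lambda>m. prob (A m))"
    by (rule summable_comparison_test'[of "\<lambda>m. (1 / 2) ^ m" 0]) (auto simp: A)
  then have AE: "AE \<omega> in M. \<forall>\<^sub>F m in sequentially. \<omega> \<in> space M - A m"
    using A by (intro borel_cantelli_AE1) (auto simp: emeasure_eq_measure)
  have short: "card F \<le> 4 * 2 ^ m"
    if \<omega>: "\<omega> \<in> space M - A m" and F: "F \<subseteq> {..<4 ^ m}" "collectable (\<lambda>i. U i \<omega>) F" for \<omega> m F
  proof (rule ccontr)
    assume "\<not> card F \<le> 4 * 2 ^ m"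
    then have le: "4 * 2 ^ m \<le> card F" by simp
    obtain G where G: "G \<subseteq> F" "card G = 4 * 2 ^ m"
      by (rule obtain_subset_with_card_n[OF le])
    have "collectable (\<lambda>i. U i \<omega>) G" using F(2) G(1) by (rule collectable_mono)
    moreover have "G \<subseteq> {..<4 ^ m}" using G(1) F(1) by (rule order_trans)
    ultimately show False using G(2) \<omega> by (simp add: A_def)
  qed
  from AE show ?thesis
  proof eventually_elim
    case (elim \<omega>)
    show ?case
      by (rule eventually_mono[OF elim]) (use short in blast)
  qed
qed

section \<open>Counting Poisson points\<close>

text \<open>
  The definition of the process asserts measurability of the counts only through their independence, so
  it is read off from a family with a single member.
\<close>

lemma (in prob_space) point_count_measurable:
  assumes "poisson_points M X" "A \<in> sets borel" "A \<subseteq> {0..}"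
  shows "point_count X A \<in> borel_measurable M"
proof -
  have "\<forall>A n. (\<forall>j<n. A j \<in> sets borel \<and> A j \<subseteq> {0..}) \<longrightarrow> disjoint_family_on A {..<n} \<longrightarrow>
      indep_vars (\<lambda>_. borel) (\<lambda>j. point_count X (A j)) {..<n::nat}"
    using assms(1) unfolding poisson_points_def by blast
  from this[rule_format, of 1 "\<lambda>_. A"]
  have "indep_vars (\<lambda>_. borel) (\<lambda>j. point_count X A) {..<1::nat}"
    using assms by (auto simp: disjoint_family_on_def)
  then show ?thesis by (auto simp: indep_vars_def)
qed

text \<open>
  Chernoff's bound for the Poisson tail: in the terms with \<open>k \<ge> n\<close> a factor \<open>2 ^ (k - n) \<ge> 1\<close> can be
  inserted, which turns them into terms of the series of \<open>exp (2 * x)\<close>, divided by \<open>2 ^ n\<close>.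
\<close>

lemma exp_tail_le:
  fixes x :: real
  assumes "0 \<le> x"
  shows "exp x - (\<Sum>k<n. x ^ k / fact k) \<le> exp (2 * x) / 2 ^ n"
proof -
  have s: "(\<lambda>k. y ^ k / fact k) sums exp y" for y :: real
    using exp_converges[of y] by (simp add: scaleR_conv_of_real divide_inverse mult.commute)
  have s': "(\<lambda>k. y ^ (k + n) / fact (k + n)) sums (exp y - (\<Sum>k<n. y ^ k / fact k))" for y :: real
    using sums_split_initial_segment[OF s[of y], of n] by simp
  have "2 ^ n * (exp x - (\<Sum>k<n. x ^ k / fact k)) \<le> exp (2 * x) - (\<Sum>k<n. (2 * x) ^ k / fact k)"
  proof (rule sums_le)
    show "(\<lambda>k. 2 ^ n * (x ^ (k + n) / fact (k + n))) sums (2 ^ n * (exp x - (\<Sum>k<n. x ^ k / fact k)))"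
      by (intro sums_mult s')
    show "(\<lambda>k. (2 * x) ^ (k + n) / fact (k + n)) sums (exp (2 * x) - (\<Sum>k<n. (2 * x) ^ k / fact k))"
      by (rule s')
    fix k
    have "(2::real) ^ n * x ^ (k + n) \<le> 2 ^ (k + n) * x ^ (k + n)"
      using assms by (intro mult_right_mono power_increasing) auto
    then show "2 ^ n * (x ^ (k + n) / fact (k + n)) \<le> (2 * x) ^ (k + n) / fact (k + n)"
      by (simp add: power_mult_distrib divide_right_mono)
  qed
  also have "\<dots> \<le> exp (2 * x)"
    using assms by (simp add: sum_nonneg)
  finally show ?thesis by (simp add: field_simps)
qed

lemma (in prob_space) prob_point_count_ge:
  assumes "poisson_points M X" "0 \<le> x"
  shows "prob {\<omega> \<in> space M. of_nat n \<le> point_count X {0..x} \<omega>} \<le> exp x / 2 ^ n"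
proof -
  have [measurable]: "point_count X {0..x} \<in> borel_measurable M"
    using assms by (intro point_count_measurable) auto
  have pois: "prob {\<omega> \<in> space M. point_count X {0..x} \<omega> = of_nat k} = x ^ k / fact k * exp (- x)" for k
    using assms unfolding poisson_points_def by (auto dest!: spec[of _ "{0..x}"] bspec[of _ _ "{0..x}"])
  \<comment> \<open>Passing to the complement reduces the tail to finitely many Poisson weights and deals with
    an infinite count at the same time.\<close>
  have eq: "{\<omega> \<in> space M. of_nat n \<le> point_count X {0..x} \<omega>} =
      space M - (\<Union>k<n. {\<omega> \<in> space M. point_count X {0..x} \<omega> = of_nat k})"
  proof -
    have "of_nat n \<le> c \<longleftrightarrow> (\<forall>k<n. c \<noteq> of_nat k)" if "c = top \<or> (\<exists>k::nat. c = of_nat k)" for c :: ennreal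
      using that by (auto simp: not_less[symmetric] less_le_trans top_unique)
    moreover have "point_count X {0..x} \<omega> = top \<or> (\<exists>k::nat. point_count X {0..x} \<omega> = of_nat k)" for \<omega>
      unfolding point_count_def by (cases "finite {i. X i \<omega> \<in> {0..x}}") auto
    ultimately show ?thesis by auto
  qed
  have "prob {\<omega> \<in> space M. of_nat n \<le> point_count X {0..x} \<omega>} =
      1 - prob (\<Union>k<n. {\<omega> \<in> space M. point_count X {0..x} \<omega> = of_nat k})"
    unfolding eq by (subst prob_compl) auto
  also have "prob (\<Union>k<n. {\<omega> \<in> space M. point_count X {0..x} \<omega> = of_nat k}) = (\<Sum>k<n. x ^ k / fact k * exp (- x))"
    by (subst finite_measure_finite_Union) (auto simp: disjoint_family_on_def pois)
  also have "1 - (\<Sum>k<n. x ^ k / fact k * exp (- x)) = exp (- x) * (exp x - (\<Sum>k<n. x ^ k / fact k))"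
    by (simp add: right_diff_distrib sum_distrib_left mult.commute exp_minus)
  also have "\<dots> \<le> exp (- x) * (exp (2 * x) / 2 ^ n)"
    using assms(2) by (intro mult_left_mono exp_tail_le) auto
  also have "\<dots> = exp x / 2 ^ n"
    by (simp add: exp_add[symmetric])
  finally show ?thesis .
qed

text \<open>
  If \<open>X (4 ^ m)\<close> is below \<open>4 ^ m / 2\<close>, then an interval of length \<open>4 ^ m / 2\<close> contains more than twice
  the expected number of points; this has probability at most \<open>(exp (1 / 2) / 2) ^ (4 ^ m)\<close>, and
  \<open>exp (1 / 2) < 2\<close>.
\<close>

lemma (in prob_space) AE_points_grow:
  assumes pp: "poisson_points M X"
  shows "AE \<omega> in M. \<forall>\<^sub>F m in sequentially. 4 ^ m / 2 \<le> X (4 ^ m) \<omega>"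
proof -
  define B where "B m = {\<omega> \<in> space M. of_nat (4 ^ m) \<le> point_count X {0..4 ^ m / 2} \<omega>}" for m :: nat
  have B: "B m \<in> events" for m
  proof -
    have [measurable]: "point_count X {0..4 ^ m / 2} \<in> borel_measurable M"
      using pp by (intro point_count_measurable) auto
    show ?thesis unfolding B_def by measurable
  qed
  have pB: "prob (B m) \<le> (7 / 8) ^ m" for m
  proof -
    have "exp (1 / 2 :: real) \<le> 7 / 4"
    proof (rule power2_le_imp_le)
      show "exp (1 / 2 :: real) ^ 2 \<le> (7 / 4) ^ 2"
        using exp_le by (simp add: exp_of_nat_mult[symmetric] power2_eq_square exp_add[symmetric])
    qed simp
    then have "exp (1 / 2 :: real) / 2 \<le> 7 / 8" by simp
    then have "(exp (1 / 2 :: real) / 2) ^ (4 ^ m) \<le> (7 / 8) ^ (4 ^ m)"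
      by (intro power_mono) auto
    also have "\<dots> \<le> (7 / 8) ^ m"
    proof (rule power_decreasing)
      have "m < 4 ^ m" by (rule power_gt_expt) simp
      then show "m \<le> 4 ^ m" by simp
    qed auto
    also have "(exp (1 / 2 :: real) / 2) ^ (4 ^ m) = exp (4 ^ m / 2) / 2 ^ (4 ^ m)"
      by (simp add: power_divide exp_of_nat_mult[symmetric])
    finally show ?thesis
      using prob_point_count_ge[OF pp, of "4 ^ m / 2" "4 ^ m"] unfolding B_def by simp
  qed
  have "summable (\<lambda>m. prob (B m))"
    by (rule summable_comparison_test'[of "\<lambda>m. (7 / 8) ^ m" 0]) (auto simp: pB)
  then have "AE \<omega> in M. \<forall>\<^sub>F m in sequentially. \<omega> \<in> space M - B m"
    using B by (intro borel_cantelli_AE1) (auto simp: emeasure_eq_measure)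
  moreover have "AE \<omega> in M. 0 \<le> X 0 \<omega> \<and> strict_mono (\<lambda>i. X i \<omega>)"
    using pp by (simp add: poisson_points_def)
  ultimately show ?thesis
  proof eventually_elim
    case (elim \<omega>)
    have "4 ^ m / 2 \<le> X (4 ^ m) \<omega>" if m: "\<omega> \<in> space M - B m" for m
    proof (rule ccontr)
      assume less: "\<not> 4 ^ m / 2 \<le> X (4 ^ m) \<omega>"
      have "X i \<omega> \<in> {0..4 ^ m / 2}" if "i < 4 ^ m" for i
      proof -
        have "X 0 \<omega> \<le> X i \<omega>" "X i \<omega> < X (4 ^ m) \<omega>"
          using that strict_mono_less_eq[OF conjunct2[OF elim(2)], of 0 i]
          strict_mono_less[OF conjunct2[OF elim(2)], of i "4 ^ m"] by simp_all
        with less elim(2) show ?thesis by auto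
      qed
      then have "emeasure (count_space UNIV) {..<4 ^ m :: nat} \<le> point_count X {0..4 ^ m / 2} \<omega>"
        unfolding point_count_def by (intro emeasure_mono) auto
      then have "of_nat (4 ^ m) \<le> point_count X {0..4 ^ m / 2} \<omega>"
        by simp
      with m show False by (simp add: B_def)
    qed
    with elim(1) show ?case by (auto elim: eventually_mono)
  qed
qed

section \<open>Uniform smallness of the tails\<close>

lemma mass_le_card_mult:
  fixes c :: real
  assumes "finite F" "\<And>i. i \<in> F \<Longrightarrow> w i \<le> c" "0 \<le> c"
  shows "mass w F \<le> ennreal (card F * c)"
proof -
  have "mass w F \<le> (\<Sum>i\<in>F. ennreal c)"
    unfolding mass_finite[OF assms(1)] using assms by (intro sum_mono ennreal_leI) auto
  also have "\<dots> = ennreal (card F * c)"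
    using assms(3) by (simp add: ennreal_mult ennreal_of_nat_eq_real_of_nat)
  finally show ?thesis .
qed

text \<open>
  Cut the indices into blocks \<open>[4 ^ m, 4 ^ (m + 1))\<close>. A collectable set has at most \<open>8 * 2 ^ m\<close> elements
  in such a block, each of weight at most \<open>(4 ^ m / 2) powr (- 1 / \<alpha>)\<close>, so the block carries at most
  \<open>D * \<rho> ^ m\<close> with \<open>\<rho> = 2 * 4 powr (- 1 / \<alpha>)\<close>, and \<open>\<rho> < 1\<close> is equivalent to \<open>\<alpha> < 2\<close>. Monotonicity
  of the weights is only demanded from index \<open>1\<close> on, because \<open>0 powr _ = 0\<close> would spoil it if the
  first Poisson point were at \<open>0\<close>.
\<close>

lemma uniformly_small_tails:
  fixes \<alpha> :: real
  assumes \<alpha>: "0 < \<alpha>" "\<alpha> < 2"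
    and nonneg: "\<And>i. 0 \<le> w i" and decr: "\<And>i j. 1 \<le> i \<Longrightarrow> i \<le> j \<Longrightarrow> w j \<le> w i"
    and short: "\<forall>\<^sub>F m in sequentially. \<forall>F. F \<subseteq> {..<4 ^ m} \<longrightarrow> collectable u F \<longrightarrow> card F \<le> 4 * 2 ^ m"
    and small: "\<forall>\<^sub>F m in sequentially. w (4 ^ m) \<le> (4 ^ m / 2) powr (- 1 / \<alpha>)"
    and e: "0 < e"
  shows "\<exists>N. \<forall>S. collectable u S \<longrightarrow> mass w (S \<inter> {N..}) \<le> ennreal e"
proof -
  define \<rho> where "\<rho> = 2 * 4 powr (- 1 / \<alpha>)"
  define D where "D = 8 * 2 powr (1 / \<alpha>)"
  have "4 powr (1 / 2) < (4::real) powr (1 / \<alpha>)"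
    using \<alpha> by (intro powr_less_mono) (auto simp: field_simps)
  then have \<rho>: "0 < \<rho>" "\<rho> < 1"
    by (auto simp: \<rho>_def powr_minus powr_half_sqrt field_simps)
  have D: "0 \<le> D" by (simp add: D_def)
  from eventually_conj[OF short small] obtain m0 where
    m0: "\<And>m F. m \<ge> m0 \<Longrightarrow> F \<subseteq> {..<4 ^ m} \<Longrightarrow> collectable u F \<Longrightarrow> card F \<le> 4 * 2 ^ m"
      "\<And>m. m \<ge> m0 \<Longrightarrow> w (4 ^ m) \<le> (4 ^ m / 2) powr (- 1 / \<alpha>)"
    unfolding eventually_sequentially by blast
  have block: "mass w (S \<inter> {4 ^ m..<4 ^ Suc m}) \<le> ennreal (D * \<rho> ^ m)"
    if S: "collectable u S" and m: "m \<ge> m0" for S m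
  proof -
    let ?F = "S \<inter> {4 ^ m..<4 ^ Suc m}"
    have fin: "finite ?F" by simp
    have "collectable u ?F" using S by (rule collectable_mono) simp
    then have "card ?F \<le> 4 * 2 ^ Suc m"
      using m by (intro m0(1)) auto
    then have card: "real (card ?F) \<le> 8 * 2 ^ m"
      using of_nat_mono[of "card ?F" "4 * 2 ^ Suc m", where 'a=real] by simp
    have "mass w ?F \<le> ennreal (card ?F * w (4 ^ m))"
      by (rule mass_le_card_mult[OF fin]) (auto intro: nonneg decr)
    also have "\<dots> \<le> ennreal ((8 * 2 ^ m) * (4 ^ m / 2) powr (- 1 / \<alpha>))"
      by (intro ennreal_leI mult_mono card m0(2) m nonneg) simp
    also have "(4 ^ m / 2) powr (- 1 / \<alpha>) = 2 powr (1 / \<alpha>) * (4 powr (- 1 / \<alpha>)) ^ m"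
      by (simp add: powr_divide powr_realpow[symmetric] powr_powr powr_minus field_simps)
    also have "(8 * 2 ^ m) * \<dots> = D * \<rho> ^ m"
      by (simp add: D_def \<rho>_def power_mult_distrib)
    finally show ?thesis .
  qed
  have "(\<lambda>n. D / (1 - \<rho>) * \<rho> ^ n) \<longlonglongrightarrow> D / (1 - \<rho>) * 0"
    by (rule tendsto_mult[OF tendsto_const LIMSEQ_power_zero]) (use \<rho> in simp)
  then have "\<forall>\<^sub>F n in sequentially. D / (1 - \<rho>) * \<rho> ^ n < e"
    by (rule order_tendstoD) (use e in simp)
  then obtain n where n: "n \<ge> m0" "D / (1 - \<rho>) * \<rho> ^ n < e"
    using eventually_happens'[OF sequentially_bot eventually_conj[OF _ eventually_ge_at_top[of m0]]]
    by blast
  have "mass w (S \<inter> {4 ^ n..}) \<le> ennreal e" if S: "collectable u S" for S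
  proof -
    have "S \<inter> {4 ^ n..} \<subseteq> (\<Union>j. S \<inter> {4 ^ (n + j)..<4 ^ Suc (n + j)})"
    proof
      fix i assume i: "i \<in> S \<inter> {4 ^ n..}"
      have "(1::nat) \<le> 4 ^ n" by simp
      also have "4 ^ n \<le> i" using i by simp
      finally obtain m where m: "4 ^ m \<le> i" "i < 4 ^ (m + 1)"
        using ex_power_ivl1[of 4 i] by auto
      have "(4::nat) ^ n < 4 ^ (m + 1)" using i m(2) by auto
      then have "n \<le> m" using power_less_imp_less_exp[of "4::nat" n "m + 1"] by simp
      then have "m = n + (m - n)" by simp
      with i m show "i \<in> (\<Union>j. S \<inter> {4 ^ (n + j)..<4 ^ Suc (n + j)})"
        by (intro UN_I[of "m - n"]) auto
    qed
    then have "mass w (S \<inter> {4 ^ n..}) \<le> mass w (\<Union>j. S \<inter> {4 ^ (n + j)..<4 ^ Suc (n + j)})"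
      by (rule mass_mono)
    also have "\<dots> \<le> (\<Sum>j. mass w (S \<inter> {4 ^ (n + j)..<4 ^ Suc (n + j)}))"
      unfolding mass_def by (rule emeasure_subadditive_countably) simp
    also have "\<dots> \<le> (\<Sum>j. ennreal (D * \<rho> ^ (n + j)))"
      using n(1) by (intro suminf_le block S) auto
    also have "\<dots> = ennreal (D / (1 - \<rho>) * \<rho> ^ n)"
    proof -
      have "(\<lambda>j. D * \<rho> ^ n * \<rho> ^ j) sums (D * \<rho> ^ n * (1 / (1 - \<rho>)))"
        using \<rho> by (intro sums_mult geometric_sums) auto
      then have "(\<lambda>j. D * \<rho> ^ (n + j)) sums (D / (1 - \<rho>) * \<rho> ^ n)"
        by (simp add: power_add mult_ac)
      then show ?thesis
        using D \<rho> by (intro suminf_ennreal_eq) auto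
    qed
    also have "\<dots> \<le> ennreal e" using n(2) by (intro ennreal_leI) simp
    finally show ?thesis .
  qed
  then show ?thesis by blast
qed

section \<open>A Poisson point is not determined by the others\<close>

text \<open>
  \<open>point_count\<close> at a fixed outcome, for arguments about a single increasing sequence.
\<close>

definition counts :: "(nat \<Rightarrow> real) \<Rightarrow> real set \<Rightarrow> ennreal" where
  "counts x A = emeasure (count_space UNIV) {l. x l \<in> A}"

lemma point_count_eq_counts: "point_count X A \<omega> = counts (\<lambda>l. X l \<omega>) A"
  by (simp add: point_count_def counts_def)

text \<open>
  This and the next two lemmas translate events about the positions of points into events about counts,
  of which the Poisson property speaks.
\<close>

lemma counts_initial_ge_iff:
  assumes x: "strict_mono x" "0 \<le> x 0"
  shows "of_nat (Suc j) \<le> counts x {0..<t} \<longleftrightarrow> x j < t"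
proof
  assume "x j < t"
  have "x l \<in> {0..<t}" if "l \<le> j" for l
    using strict_mono_less_eq[OF x(1), of l j] strict_mono_less_eq[OF x(1), of 0 l] that x(2) \<open>x j < t\<close>
    by simp
  then have "emeasure (count_space UNIV) {..j} \<le> counts x {0..<t}"
    unfolding counts_def by (intro emeasure_mono) auto
  then show "of_nat (Suc j) \<le> counts x {0..<t}" by simp
next
  assume le: "of_nat (Suc j) \<le> counts x {0..<t}"
  show "x j < t"
  proof (rule ccontr)
    assume "\<not> x j < t"
    have "l < j" if "x l < t" for l
      using strict_mono_less[OF x(1), of l j] that \<open>\<not> x j < t\<close> by linarith
    then have "counts x {0..<t} \<le> emeasure (count_space UNIV) {..<j}"
      unfolding counts_def by (intro emeasure_mono) auto
    then have "counts x {0..<t} \<le> of_nat j" by simp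
    with le have "of_nat (Suc j) \<le> (of_nat j :: ennreal)" by (rule order_trans)
    then have "Suc j \<le> j" by (simp only: of_nat_le_iff)
    then show False by simp
  qed
qed

text \<open>
  When \<open>[a, b)\<close> contains exactly the \<open>i\<close>-th point, the position of a later point can be read off from
  the counts outside \<open>[a, b)\<close> alone; the missing \<open>i\<close>-th point lowers the required count from \<open>j + 1\<close> to \<open>j\<close>.
\<close>

lemma counts_gap_ge_iff:
  assumes x: "strict_mono x" "0 \<le> x 0"
    and isolated: "\<And>l. l < i \<Longrightarrow> x l < a" "a \<le> x i" "x i < b" "b \<le> x (Suc i)" "0 \<le> a" and j: "i < j"
  shows "of_nat j \<le> counts x ({0..<a} \<union> {b..<t}) \<longleftrightarrow> x j < t"
proof
  assume "x j < t"
  have "x l \<in> {0..<a} \<union> {b..<t}" if l: "l \<le> j" "l \<noteq> i" for l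
  proof (cases "l < i")
    case True
    then show ?thesis
      using isolated(1)[of l] strict_mono_less_eq[OF x(1), of 0 l] x(2) by auto
  next
    case False
    with l have "Suc i \<le> l" by simp
    then have "b \<le> x l" using strict_mono_less_eq[OF x(1), of "Suc i" l] isolated(4) by simp
    moreover have "x l \<le> x j" using strict_mono_less_eq[OF x(1), of l j] l by simp
    ultimately show ?thesis using \<open>x j < t\<close> by auto
  qed
  then have "emeasure (count_space UNIV) ({..j} - {i}) \<le> counts x ({0..<a} \<union> {b..<t})"
    unfolding counts_def by (intro emeasure_mono) auto
  moreover have "card ({..j} - {i}) = j" using j by (simp add: card_Diff_singleton)
  ultimately show "of_nat j \<le> counts x ({0..<a} \<union> {b..<t})" by simp
next
  assume le: "of_nat j \<le> counts x ({0..<a} \<union> {b..<t})"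
  show "x j < t"
  proof (rule ccontr)
    assume nl: "\<not> x j < t"
    have "l \<in> {..<j} - {i}" if l: "x l \<in> {0..<a} \<union> {b..<t}" for l
    proof -
      have "l \<noteq> i" using l isolated(2,3) by auto
      moreover have "l < j"
      proof (cases "x l < a")
        case True
        then have "x l < x i" using isolated(2) by simp
        then have "l < i" by (simp add: strict_mono_less[OF x(1)])
        with j show ?thesis by simp
      next
        case False
        with l nl have "x l < x j" by auto
        then show ?thesis by (simp add: strict_mono_less[OF x(1)])
      qed
      ultimately show ?thesis by simp
    qed
    then have "counts x ({0..<a} \<union> {b..<t}) \<le> emeasure (count_space UNIV) ({..<j} - {i})"
      unfolding counts_def by (intro emeasure_mono) auto
    moreover have "card ({..<j} - {i}) = j - 1" using j by (simp add: card_Diff_singleton)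
    ultimately have "counts x ({0..<a} \<union> {b..<t}) \<le> of_nat (j - 1)" by simp
    with le have "of_nat j \<le> (of_nat (j - 1) :: ennreal)" by (rule order_trans)
    then have "j \<le> j - 1" by (simp only: of_nat_le_iff)
    then show False using j by simp
  qed
qed

lemma counts_eq_0_iff: "counts x A = 0 \<longleftrightarrow> (\<forall>l. x l \<notin> A)"
  by (cases "finite {l. x l \<in> A}") (auto simp: counts_def dest: not_finite_existsD)

lemma counts_eq_1_iff: "counts x A = 1 \<longleftrightarrow> (\<exists>!l. x l \<in> A)"
proof -
  have "counts x A = 1 \<longleftrightarrow> card {l. x l \<in> A} = 1"
    by (cases "finite {l. x l \<in> A}") (auto simp: counts_def one_ennreal_def[symmetric])
  also have "\<dots> \<longleftrightarrow> (\<exists>!l. x l \<in> A)"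
    by (auto simp: card_1_singleton_iff set_eq_iff)
  finally show ?thesis .
qed

text \<open>
  The event that \<open>[a, b)\<close> isolates the \<open>i\<close>-th point and this point lies in \<open>J\<close>, expressed by counts in
  disjoint sets.
\<close>

lemma isolated_iff_counts:
  assumes x: "strict_mono x" "0 \<le> x 0" and J: "J \<subseteq> {a..<b}" and "0 \<le> a"
  shows "counts x J = 1 \<and> counts x ({a..<b} - J) = 0 \<and> counts x {0..<a} = of_nat i \<longleftrightarrow>
    (\<forall>l<i. x l < a) \<and> a \<le> x i \<and> x i < b \<and> b \<le> x (Suc i) \<and> x i \<in> J" (is "?L \<longleftrightarrow> ?R")
proof
  assume L: ?L
  have below: "x l < a \<longleftrightarrow> l < i" for l
    using L by (simp only: counts_initial_ge_iff[OF x, symmetric] of_nat_le_iff Suc_le_eq)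
  from L obtain k where k: "x k \<in> J" and uniq: "\<And>l. x l \<in> J \<Longrightarrow> l = k"
    unfolding counts_eq_1_iff by blast
  have inJ: "x l \<in> J" if "a \<le> x l" "x l < b" for l
    using L that by (auto simp: counts_eq_0_iff)
  have i: "a \<le> x i" using below[of i] by simp
  have "a \<le> x k" "x k < b" using k J by auto
  then have "i \<le> k" using below[of k] by simp
  then have "x i < b" using \<open>x k < b\<close> strict_mono_less_eq[OF x(1), of i k] by simp
  then have "x i \<in> J" using inJ i by simp
  have "x i < x (Suc i)" using x(1) by (simp add: strict_mono_less)
  have "b \<le> x (Suc i)"
  proof (rule ccontr)
    assume "\<not> b \<le> x (Suc i)"
    then have "x (Suc i) \<in> J" using inJ[of "Suc i"] i \<open>x i < x (Suc i)\<close> by simp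
    with \<open>x i \<in> J\<close> uniq have "Suc i = i" by metis
    then show False by simp
  qed
  then show ?R using below i \<open>x i < b\<close> \<open>x i \<in> J\<close> by simp
next
  assume R: ?R
  have mid: "l = i" if "a \<le> x l" "x l < b" for l
  proof -
    have "\<not> l < i" using R that by auto
    moreover have "\<not> Suc i \<le> l"
      using R that strict_mono_less_eq[OF x(1), of "Suc i" l] by auto
    ultimately show ?thesis by simp
  qed
  have "\<exists>!l. x l \<in> J"
  proof (rule ex1I)
    show "x i \<in> J" using R by simp
    show "l = i" if "x l \<in> J" for l using that J by (intro mid) auto
  qed
  moreover have "x l \<notin> {a..<b} - J" for l
  proof
    assume l: "x l \<in> {a..<b} - J"
    then have "l = i" by (intro mid) auto
    with l R show False by simp
  qed
  moreover have "{l. x l \<in> {0..<a}} = {..<i}"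
  proof safe
    fix l assume "x l \<in> {0..<a}"
    then have "x l < x i" using R by auto
    then show "l < i" by (simp add: strict_mono_less[OF x(1)])
  next
    fix l assume "l < i"
    then show "x l \<in> {0..<a}" using R x(2) strict_mono_less_eq[OF x(1), of 0 l] by auto
  qed
  ultimately show ?L
    unfolding counts_eq_0_iff counts_eq_1_iff by (simp add: counts_def)
qed

text \<open>
  The sets \<open>B q\<close> may overlap, while the Poisson property only speaks about disjoint sets. So the counts in
  the \<open>B q\<close> are written as sums of the counts in the finitely many atoms that the \<open>B q\<close> generate.
  These atoms together with \<open>C1\<close> and \<open>C2\<close> are disjoint.
\<close>

lemma (in prob_space) poisson_indep_outside:
  assumes pp: "poisson_points M X"
    and C: "C1 \<in> sets borel" "C2 \<in> sets borel" "C1 \<inter> C2 = {}" "C1 \<subseteq> {0..}" "C2 \<subseteq> {0..}"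
      "emeasure lborel C1 < \<infinity>" "emeasure lborel C2 < \<infinity>"
    and I: "finite I"
    and B: "\<And>q. q \<in> I \<Longrightarrow> B q \<in> sets borel" "\<And>q. q \<in> I \<Longrightarrow> B q \<subseteq> {0..} - (C1 \<union> C2)"
    and T: "\<And>q. q \<in> I \<Longrightarrow> T q \<in> sets borel"
  shows "prob {\<omega> \<in> space M. point_count X C1 \<omega> = 1 \<and> point_count X C2 \<omega> = 0 \<and> (\<forall>q\<in>I. point_count X (B q) \<omega> \<in> T q)} =
    measure lborel C1 * exp (- measure lborel C1) * exp (- measure lborel C2) *
      prob {\<omega> \<in> space M. \<forall>q\<in>I. point_count X (B q) \<omega> \<in> T q}"
proof -
  define atom where "atom Z = {x \<in> {0..} - (C1 \<union> C2). \<forall>q\<in>I. x \<in> B q \<longleftrightarrow> q \<in> Z}" for Z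
  have atom_alt: "atom Z = ({0..} - (C1 \<union> C2)) \<inter> (\<Inter>q\<in>I. if q \<in> Z then B q else - B q)" for Z
    by (auto simp: atom_def)
  have atom_sets: "atom Z \<in> sets borel" for Z
    unfolding atom_alt
  proof (cases "I = {}")
    case False
    have "(\<Inter>q\<in>I. if q \<in> Z then B q else - B q) \<in> sets borel"
      using B(1) by (intro sets.finite_INT I False) (auto intro: borel_comp)
    then show "({0..} - (C1 \<union> C2)) \<inter> (\<Inter>q\<in>I. if q \<in> Z then B q else - B q) \<in> sets borel"
      using C by (intro sets.Int sets.Diff sets.Un) auto
  qed (use C in auto)
  obtain f n where f: "bij_betw f {..<n::nat} (Pow I)"
    using ex_bij_betw_nat_finite[of "Pow I"] I by (auto simp: atLeast0LessThan)
  \<comment> \<open>Positions \<open>0\<close> and \<open>1\<close> hold \<open>C1\<close> and \<open>C2\<close>; the atoms follow from position \<open>2\<close> on.\<close>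
  define A where "A j = (if j = 0 then C1 else if j = 1 then C2 else atom (f (j - 2)))" for j
  have A_sets: "A j \<in> sets borel \<and> A j \<subseteq> {0..}" for j
    using C atom_sets by (auto simp: A_def atom_def)
  have "disjoint_family_on A {..<n + 2}"
    unfolding disjoint_family_on_def
  proof (intro ballI impI)
    fix j k assume jk: "j \<in> {..<n + 2}" "k \<in> {..<n + 2}" "j \<noteq> k"
    show "A j \<inter> A k = {}"
    proof (cases "j < 2 \<or> k < 2")
      case True
      then show ?thesis using C(3) jk(3) by (auto simp: A_def atom_def less_2_cases_iff)
    next
      case False
      have "f (j - 2) \<noteq> f (k - 2)"
        using f jk False unfolding bij_betw_def by (auto dest!: inj_onD[of f _ "j - 2" "k - 2"])
      moreover have "f (j - 2) \<subseteq> I" "f (k - 2) \<subseteq> I"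
        using jk False bij_betwE[OF f] by auto
      ultimately show ?thesis
        using False by (auto simp: A_def atom_def)
    qed
  qed
  then have ind: "indep_vars (\<lambda>_. borel) (\<lambda>j. point_count X (A j)) {..<n + 2}"
    using pp A_sets unfolding poisson_points_def by blast
  have meas: "point_count X (A j) \<in> borel_measurable M" for j
    using A_sets[of j] by (intro point_count_measurable[OF pp]) auto
  define R where "R = (\<lambda>q. {j \<in> {2..<n + 2}. q \<in> f (j - 2)})"
  have B_sum: "point_count X (B q) \<omega> = (\<Sum>j\<in>R q. point_count X (A j) \<omega>)" if q: "q \<in> I" for q \<omega>
  proof -
    have "B q = (\<Union>j\<in>R q. A j)"
    proof (intro equalityI subsetI)
      fix x assume x: "x \<in> B q"
      define Z where "Z = {q \<in> I. x \<in> B q}"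
      have "Z \<in> Pow I" by (auto simp: Z_def)
      then have "Z \<in> f ` {..<n}" using f by (simp add: bij_betw_def)
      then obtain k where k: "k < n" "f k = Z" by auto
      have "x \<in> atom Z" using B(2)[OF q] x by (auto simp: atom_def Z_def)
      with k q x show "x \<in> (\<Union>j\<in>R q. A j)"
        by (intro UN_I[of "k + 2"]) (auto simp: R_def A_def Z_def)
    next
      fix x assume "x \<in> (\<Union>j\<in>R q. A j)"
      with q show "x \<in> B q" by (auto simp: R_def A_def atom_def)
    qed
    then have "{l. X l \<omega> \<in> B q} = (\<Union>j\<in>R q. {l. X l \<omega> \<in> A j})" by auto
    moreover have "disjoint_family_on (\<lambda>j. {l. X l \<omega> \<in> A j}) (R q)"
      using \<open>disjoint_family_on A {..<n + 2}\<close> unfolding disjoint_family_on_def R_def by fastforce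
    ultimately show ?thesis
      unfolding point_count_def by (simp add: sum_emeasure R_def)
  qed
  let ?L = "\<lambda>j. point_count X (A j)"
  define S1 where "S1 = {y \<in> space (Pi\<^sub>M {0, 1::nat} (\<lambda>_. borel)). y 0 = (1::ennreal) \<and> y 1 = 0}"
  define S2 where "S2 = {y \<in> space (Pi\<^sub>M {2..<n + 2} (\<lambda>_. borel)). \<forall>q\<in>I. (\<Sum>j\<in>R q. y j :: ennreal) \<in> T q}"
  have S1: "S1 \<in> sets (Pi\<^sub>M {0, 1} (\<lambda>_. borel))" unfolding S1_def by measurable
  have "Measurable.pred (Pi\<^sub>M {2..<n + 2} (\<lambda>_. borel)) (\<lambda>y. (\<Sum>j\<in>R q. y j :: ennreal) \<in> T q)" if "q \<in> I" for q
    using T[OF that] by (rule pred_sets2) (auto simp: R_def intro!: borel_measurable_sum)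
  then have S2: "S2 \<in> sets (Pi\<^sub>M {2..<n + 2} (\<lambda>_. borel))"
    unfolding S2_def pred_def[symmetric] by (intro pred_intros_finite I)
  have "indep_var (Pi\<^sub>M {0, 1} (\<lambda>_. borel)) (\<lambda>\<omega>. \<lambda>j\<in>{0, 1}. ?L j \<omega>)
      (Pi\<^sub>M {2..<n + 2} (\<lambda>_. borel)) (\<lambda>\<omega>. \<lambda>j\<in>{2..<n + 2}. ?L j \<omega>)"
    by (rule indep_var_restrict[OF ind]) auto
  note split = indep_varD[OF this S1 S2]
  have L0: "?L 0 = point_count X C1" "?L (Suc 0) = point_count X C2" by (simp_all add: A_def)
  have e1: "(\<lambda>\<omega>. \<lambda>j\<in>{0, 1}. ?L j \<omega>) -` S1 \<inter> space M = {\<omega> \<in> space M. point_count X C1 \<omega> = 1 \<and> point_count X C2 \<omega> = 0}"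
    by (auto simp: S1_def space_PiM L0)
  have "(\<lambda>\<omega>. \<lambda>j\<in>{2..<n + 2}. ?L j \<omega>) -` S2 \<inter> space M =
      {\<omega> \<in> space M. \<forall>q\<in>I. (\<Sum>j\<in>R q. (\<lambda>j\<in>{2..<n + 2}. ?L j \<omega>) j) \<in> T q}"
    by (auto simp: S2_def space_PiM)
  also have "\<dots> = {\<omega> \<in> space M. \<forall>q\<in>I. point_count X (B q) \<omega> \<in> T q}"
  proof -
    have "(\<Sum>j\<in>R q. (\<lambda>j\<in>{2..<n + 2}. ?L j \<omega>) j) = point_count X (B q) \<omega>" if "q \<in> I" for q \<omega>
      unfolding B_sum[OF that] by (intro sum.cong) (auto simp: R_def)
    then show ?thesis by auto
  qed
  finally have e2: "(\<lambda>\<omega>. \<lambda>j\<in>{2..<n + 2}. ?L j \<omega>) -` S2 \<inter> space M = \<dots>" .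
  have pois: "prob {\<omega> \<in> space M. point_count X C \<omega> = of_nat k} = measure lborel C ^ k / fact k * exp (- measure lborel C)"
    if "C \<in> sets borel" "C \<subseteq> {0..}" "emeasure lborel C < \<infinity>" for C k
    using pp that unfolding poisson_points_def by blast
  have "prob {\<omega> \<in> space M. point_count X C1 \<omega> = 1 \<and> point_count X C2 \<omega> = 0} =
      prob (\<Inter>j\<in>{0, 1::nat}. ?L j -` (if j = 0 then {1} else {0}) \<inter> space M)"
    by (intro arg_cong[where f=prob]) (auto simp: L0)
  also have "\<dots> = (\<Prod>j\<in>{0, 1::nat}. prob (?L j -` (if j = 0 then {1} else {0}) \<inter> space M))"
    by (intro indep_varsD[OF ind]) auto
  also have "\<dots> = prob {\<omega> \<in> space M. point_count X C1 \<omega> = of_nat 1} * prob {\<omega> \<in> space M. point_count X C2 \<omega> = of_nat 0}"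
    by (auto simp: L0 intro!: arg_cong2[where f="(*)"] arg_cong[where f=prob])
  also have "\<dots> = measure lborel C1 * exp (- measure lborel C1) * exp (- measure lborel C2)"
    using C by (simp only: pois) simp
  finally have p1: "prob {\<omega> \<in> space M. point_count X C1 \<omega> = 1 \<and> point_count X C2 \<omega> = 0} = \<dots>" .
  have "{\<omega> \<in> space M. point_count X C1 \<omega> = 1 \<and> point_count X C2 \<omega> = 0 \<and> (\<forall>q\<in>I. point_count X (B q) \<omega> \<in> T q)} =
      (\<lambda>\<omega>. (\<lambda>j\<in>{0, 1}. ?L j \<omega>, \<lambda>j\<in>{2..<n + 2}. ?L j \<omega>)) -` (S1 \<times> S2) \<inter> space M"
    using e1 e2 by blast
  then show ?thesis
    by (simp only: split e1 e2 p1)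
qed

text \<open>
  Given that \<open>[a, b)\<close> contains exactly the \<open>i\<close>-th point, this point is equally likely to lie in each of
  \<open>n\<close> cells of equal length, independently of the other points, hence independently of the value
  \<open>h\<close> predicted from them. So the prediction hits the correct cell with probability at most that of a
  single cell containing one point, which is at most \<open>(b - a) / n\<close>.

  The independence is proved as equality of the measures \<open>A \<mapsto> prob (E k \<inter> A)\<close> for all cells \<open>k\<close>, on
  the sigma-algebra generated by the other points; it suffices to check finite intersections of
  events \<open>X j < t\<close> with \<open>j \<noteq> i\<close>, which on \<open>E k\<close> are events about counts outside \<open>[a, b)\<close>.
\<close>

lemma (in prob_space) AE_isolated_point_ne:
  assumes pp: "poisson_points M X"
    and h: "h \<in> borel_measurable (Pi\<^sub>M UNIV (\<lambda>_::nat. borel))" and hupd: "\<And>x c. h (x(i := c)) = (h x :: real)"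
    and ab: "0 \<le> a" "a < b"
  shows "AE \<omega> in M. \<not> ((\<forall>l<i. X l \<omega> < a) \<and> a \<le> X i \<omega> \<and> X i \<omega> < b \<and> b \<le> X (Suc i) \<omega> \<and>
    X i \<omega> = h (\<lambda>j. X j \<omega>))"
proof -
  have X [measurable]: "X j \<in> borel_measurable M" for j
    using pp by (simp add: poisson_points_def)
  have order: "AE \<omega> in M. strict_mono (\<lambda>j. X j \<omega>) \<and> 0 \<le> X 0 \<omega>"
    using pp by (simp add: poisson_points_def conj_commute)
  define Gen where "Gen S = {\<omega> \<in> space M. \<forall>(j, t)\<in>S. X j \<omega> < t}" for S :: "(nat \<times> real) set"
  define \<G> where "\<G> = {Gen S | S. finite S \<and> S \<subseteq> (- {i}) \<times> UNIV}"
  have Gen_events: "Gen S \<in> events" if "finite S" for S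
    unfolding Gen_def pred_def[symmetric] case_prod_beta
    by (intro pred_intros_finite that) measurable
  have Gen_Int: "Gen S \<inter> Gen S' = Gen (S \<union> S')" for S S'
    by (auto simp: Gen_def)
  have stable: "Int_stable \<G>"
  proof (rule Int_stableI)
    fix A B assume "A \<in> \<G>" "B \<in> \<G>"
    then obtain S S' where "A = Gen S" "B = Gen S'" "finite S" "finite S'"
      "S \<subseteq> (- {i}) \<times> UNIV" "S' \<subseteq> (- {i}) \<times> UNIV"
      by (auto simp: \<G>_def)
    then show "A \<inter> B \<in> \<G>"
      unfolding \<G>_def by (intro CollectI exI[of _ "S \<union> S'"]) (auto simp: Gen_Int)
  qed
  have \<G>_events: "\<G> \<subseteq> events" using Gen_events by (auto simp: \<G>_def)
  then have \<G>_Pow: "\<G> \<subseteq> Pow (space M)" using sets.sets_into_space by blast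
  have sig_events: "sigma_sets (space M) \<G> \<subseteq> events"
    using \<G>_events by (rule sets.sigma_sets_subset)
  \<comment> \<open>Overwriting the \<open>i\<close>-th coordinate by a constant does not change \<open>h\<close> and makes the sequence
    measurable with respect to the other points.\<close>
  define Y where "Y \<omega> = (\<lambda>j. X j \<omega>)(i := 0)" for \<omega>
  have "Y \<in> sigma (space M) \<G> \<rightarrow>\<^sub>M Pi\<^sub>M UNIV (\<lambda>_. borel)"
  proof (rule measurable_PiM_single')
    fix j :: nat
    show "(\<lambda>\<omega>. Y \<omega> j) \<in> borel_measurable (sigma (space M) \<G>)"
    proof (cases "j = i")
      case False
      have "{\<omega> \<in> space M. X j \<omega> < t} \<in> \<G>" for t
        using False unfolding \<G>_def by (intro CollectI exI[of _ "{(j, t)}"]) (auto simp: Gen_def)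
      then show ?thesis
        using False \<G>_Pow by (auto simp: borel_measurable_iff_less Y_def space_measure_of_conv sets_measure_of)
    qed (simp add: Y_def)
  qed auto
  then have "(\<lambda>\<omega>. h (Y \<omega>)) \<in> borel_measurable (sigma (space M) \<G>)"
    using h by (rule measurable_compose)
  then have hY: "{\<omega> \<in> space M. h (\<lambda>j. X j \<omega>) \<in> C} \<in> sigma_sets (space M) \<G>" if "C \<in> sets borel" for C
    using measurable_sets[of "\<lambda>\<omega>. h (Y \<omega>)" "sigma (space M) \<G>" borel C] that \<G>_Pow
    by (simp add: Y_def hupd space_measure_of_conv sets_measure_of vimage_def Int_def conj_commute)
  define Bad where "Bad = {\<omega> \<in> space M. (\<forall>l<i. X l \<omega> < a) \<and> a \<le> X i \<omega> \<and> X i \<omega> < b \<and> b \<le> X (Suc i) \<omega> \<and>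
    X i \<omega> = h (\<lambda>j. X j \<omega>)}"
  have hX: "(\<lambda>\<omega>. h (\<lambda>j. X j \<omega>)) \<in> borel_measurable M"
    by (rule measurable_compose[OF _ h]) (auto intro: measurable_PiM_single')
  have Bad: "Bad \<in> events"
    unfolding Bad_def using hX by measurable
  have bound: "prob Bad \<le> (b - a) / n" if "n > 0" for n :: nat
  proof -
    define d where "d = (b - a) / n"
    have d: "d > 0" "n * d = b - a" using that ab by (auto simp: d_def)
    define J where "J k = {a + real k * d..<a + real (Suc k) * d}" for k
    have Jsub: "J k \<subseteq> {a..<b}" if "k < n" for k
    proof -
      have "real (Suc k) * d \<le> real n * d" "0 \<le> real k * d" using that d(1) by (auto intro!: mult_right_mono)
      then show ?thesis unfolding J_def using d(2) by auto
    qed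
    have Jcover: "\<exists>k<n. y \<in> J k" if y: "a \<le> y" "y < b" for y
    proof -
      define k where "k = nat \<lfloor>(y - a) / d\<rfloor>"
      have nn: "0 \<le> (y - a) / d" using y d by simp
      then have k: "real k \<le> (y - a) / d" "(y - a) / d < real k + 1"
        unfolding k_def by linarith+
      have "real k * d \<le> y - a" "y - a < (real k + 1) * d"
        using k d(1) by (simp_all add: pos_le_divide_eq pos_divide_less_eq)
      then have "y \<in> J k" by (simp add: J_def algebra_simps)
      moreover have "real k * d < n * d" using \<open>real k * d \<le> y - a\<close> y d(2) by linarith
      then have "k < n" using d(1) by simp
      ultimately show ?thesis by blast
    qed
    have Jdisj: "J k \<inter> J l = {}" if "k < l" for k l
    proof -
      have "real (Suc k) * d \<le> real l * d" using that d(1) by (intro mult_right_mono) auto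
      then show ?thesis by (auto simp: J_def)
    qed
    have Jdisj': "disjoint_family_on J {..<n}"
      unfolding disjoint_family_on_def using Jdisj by (metis Int_commute linorder_neqE_nat)
    define E where "E k = {\<omega> \<in> space M. point_count X (J k) \<omega> = 1 \<and> point_count X ({a..<b} - J k) \<omega> = 0 \<and>
      point_count X {0..<a} \<omega> = of_nat i}" for k
    have E_events: "E k \<in> events" if "k < n" for k
    proof -
      have [measurable]: "point_count X (J k) \<in> borel_measurable M"
         "point_count X ({a..<b} - J k) \<in> borel_measurable M" "point_count X {0..<a} \<in> borel_measurable M"
        using ab Jsub[OF that] by (intro point_count_measurable[OF pp]; auto simp: J_def)+
      show ?thesis unfolding E_def by measurable
    qed
    have E_iff: "\<omega> \<in> E k \<longleftrightarrow> (\<forall>l<i. X l \<omega> < a) \<and> a \<le> X i \<omega> \<and> X i \<omega> < b \<and> b \<le> X (Suc i) \<omega> \<and> X i \<omega> \<in> J k"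
      if "\<omega> \<in> space M" "strict_mono (\<lambda>j. X j \<omega>)" "0 \<le> X 0 \<omega>" "k < n" for \<omega> k
      using isolated_iff_counts[OF that(2,3) Jsub[OF that(4)] ab(1), of i] that(1)
      by (simp add: E_def point_count_eq_counts)
    have lJ: "measure lborel (J k) = d" "emeasure lborel (J k) < \<infinity>" for k
      using d(1) by (simp_all add: J_def algebra_simps)
    have lrest: "measure lborel ({a..<b} - J k) = (b - a) - d" "emeasure lborel ({a..<b} - J k) < \<infinity>" if "k < n" for k
    proof -
      have fm: "{a..<b} \<in> fmeasurable lborel" "J k \<in> sets lborel"
        using less_imp_le[OF ab(2)] by (auto simp: fmeasurable_def J_def)
      then show "measure lborel ({a..<b} - J k) = (b - a) - d"
        using measurable_measure_Diff[OF fm Jsub[OF that]] ab by (simp add: lJ)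
      have "emeasure lborel ({a..<b} - J k) \<le> emeasure lborel {a..<b}"
        by (intro emeasure_mono) auto
      also have "\<dots> < \<infinity>" using less_imp_le[OF ab(2)] by simp
      finally show "emeasure lborel ({a..<b} - J k) < \<infinity>" .
    qed
    \<comment> \<open>The right-hand side does not involve \<open>k\<close>. The index \<open>(i, a)\<close> does not occur in \<open>S\<close> and carries the condition
      that exactly \<open>i\<close> points precede \<open>a\<close>.\<close>
    have gen: "prob (E k \<inter> Gen S) = d * exp (- d) * exp (- ((b - a) - d)) *
        prob {\<omega> \<in> space M. \<forall>(j, t)\<in>insert (i, a) S.
          point_count X (if j = i then {0..<a} else if j < i then {0..<min t a} else {0..<a} \<union> {b..<t}) \<omega> \<in>
            (if j = i then {of_nat i} else if j < i then {of_nat (Suc j)..} else {of_nat j..})}"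
      if S: "finite S" "S \<subseteq> (- {i}) \<times> UNIV" and k: "k < n" for S k
    proof -
      define B where "B = (\<lambda>(j, t). if j = i then {0..<a} else if j < i then {0..<min t a} else {0..<a} \<union> {b..<t})"
      define T where "T = (\<lambda>(j, t::real). if j = i then {of_nat i} else if j < i then {of_nat (Suc j)..} else {of_nat j :: ennreal..})"
      let ?H = "{\<omega> \<in> space M. \<forall>q\<in>insert (i, a) S. point_count X (B q) \<omega> \<in> T q}"
      let ?E = "{\<omega> \<in> space M. point_count X (J k) \<omega> = 1 \<and> point_count X ({a..<b} - J k) \<omega> = 0 \<and>
          (\<forall>q\<in>insert (i, a) S. point_count X (B q) \<omega> \<in> T q)}"
      have B: "B q \<in> sets borel" "B q \<subseteq> {0..} - (J k \<union> ({a..<b} - J k))" for q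
        using ab Jsub[OF k] by (auto simp: B_def split: prod.splits)
      have Js: "J k \<in> sets borel" and restS: "{a..<b} - J k \<in> sets borel" by (simp_all add: J_def)
      have "{a..<b} \<subseteq> {0..}" using ab by auto
      then have Jpos: "J k \<subseteq> {0..}" and restpos: "{a..<b} - J k \<subseteq> {0..}" using Jsub[OF k] by blast+
      have Bm: "point_count X (B q) \<in> borel_measurable M" for q
        using B[of q] by (intro point_count_measurable[OF pp]) auto
      have T: "T q \<in> sets borel" for q by (auto simp: T_def split: prod.splits)
      have indep: "prob ?E = d * exp (- d) * exp (- ((b - a) - d)) * prob ?H"
        using poisson_indep_outside[OF pp Js restS _ Jpos restpos lJ(2) lrest(2)[OF k], of "insert (i, a) S" B T]
          S(1) B T by (auto simp: lJ lrest[OF k])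
      have ?thesis if "prob (E k \<inter> Gen S) = prob ?E"
        unfolding that indep by (simp add: B_def T_def case_prod_beta)
      moreover have "prob (E k \<inter> Gen S) = prob ?E"
      proof (rule finite_measure_eq_AE)
        show "E k \<inter> Gen S \<in> events" using E_events[OF k] Gen_events[OF S(1)] by simp
        have E_eq: "?E = {\<omega> \<in> space M. point_count X (J k) \<omega> = 1 \<and> point_count X ({a..<b} - J k) \<omega> = 0} \<inter> ?H"
          by auto
        have [measurable]: "point_count X (J k) \<in> borel_measurable M"
           "point_count X ({a..<b} - J k) \<in> borel_measurable M"
          using ab Jsub[OF k] Js by (intro point_count_measurable[OF pp]; auto)+
        have "?H \<in> events"
          unfolding pred_def[symmetric] using S(1)
          by (intro pred_intros_finite pred_sets2[OF T Bm]) simp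
        then show "?E \<in> events" unfolding E_eq by measurable
        show "AE \<omega> in M. \<omega> \<in> E k \<inter> Gen S \<longleftrightarrow> \<omega> \<in> ?E"
          using order
        proof (rule AE_mp, intro AE_I2 impI)
          fix \<omega> assume \<omega>: "\<omega> \<in> space M" and ord: "strict_mono (\<lambda>j. X j \<omega>) \<and> 0 \<le> X 0 \<omega>"
          have cond: "point_count X (B (j, t)) \<omega> \<in> T (j, t) \<longleftrightarrow> X j \<omega> < t"
            if iso: "(\<forall>l<i. X l \<omega> < a) \<and> a \<le> X i \<omega> \<and> X i \<omega> < b \<and> b \<le> X (Suc i) \<omega>" and "j \<noteq> i" for j t
          proof (cases "j < i")
            case True
            then have "point_count X (B (j, t)) \<omega> \<in> T (j, t) \<longleftrightarrow> X j \<omega> < min t a"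
              using counts_initial_ge_iff[of "\<lambda>l. X l \<omega>" j "min t a"] ord
              by (simp add: B_def T_def point_count_eq_counts)
            with True iso show ?thesis by auto
          next
            case False
            with that have "i < j" by simp
            then show ?thesis
              using counts_gap_ge_iff[of "\<lambda>l. X l \<omega>" i a b j t] ord iso ab
              by (simp add: B_def T_def point_count_eq_counts)
          qed
          have "\<omega> \<in> ?E \<longleftrightarrow> \<omega> \<in> E k \<and> (\<forall>q\<in>S. point_count X (B q) \<omega> \<in> T q)"
            using \<omega> by (auto simp: E_def B_def T_def)
          also have "\<dots> \<longleftrightarrow> \<omega> \<in> E k \<and> (\<forall>(j, t)\<in>S. X j \<omega> < t)"
          proof (rule conj_cong[OF refl])
            assume "\<omega> \<in> E k"
            with E_iff[OF \<omega> _ _ k] ord have iso: "(\<forall>l<i. X l \<omega> < a) \<and> a \<le> X i \<omega> \<and> X i \<omega> < b \<and> b \<le> X (Suc i) \<omega>"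
              by blast
            have "point_count X (B q) \<omega> \<in> T q \<longleftrightarrow> (case q of (j, t) \<Rightarrow> X j \<omega> < t)" if "q \<in> S" for q
            proof -
              have "fst q \<noteq> i" using that S(2) by auto
              from cond[OF iso this, of "snd q"] show ?thesis by (simp add: case_prod_beta)
            qed
            then show "(\<forall>q\<in>S. point_count X (B q) \<omega> \<in> T q) \<longleftrightarrow> (\<forall>(j, t)\<in>S. X j \<omega> < t)" by auto
          qed
          finally show "\<omega> \<in> E k \<inter> Gen S \<longleftrightarrow> \<omega> \<in> ?E" using \<omega> by (auto simp: Gen_def)
        qed
      qed
      ultimately show ?thesis by blast
    qed
    have same: "prob (E k \<inter> A) = prob (E 0 \<inter> A)" if A: "A \<in> sigma_sets (space M) \<G>" and k: "k < n" for k A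
      using stable \<G>_Pow A
    proof (induction rule: sigma_sets_induct_disjoint)
      case (basic A)
      then obtain S where S: "A = Gen S" "finite S" "S \<subseteq> (- {i}) \<times> UNIV"
        unfolding \<G>_def by blast
      show ?case
        unfolding S(1) gen[OF S(2,3) k] gen[OF S(2,3) \<open>n > 0\<close>] ..
    next
      case empty
      show ?case by simp
    next
      case (compl A)
      have "prob (E l \<inter> (space M - A)) = prob (E l \<inter> space M) - prob (E l \<inter> A)" if "l < n" for l
      proof -
        have "A \<in> events" using compl.hyps sig_events by blast
        then have "prob (E l \<inter> space M - E l \<inter> A) = prob (E l \<inter> space M) - prob (E l \<inter> A)"
          using E_events[OF that] sets.sets_into_space by (intro finite_measure_Diff) auto
        moreover have "E l \<inter> (space M - A) = E l \<inter> space M - E l \<inter> A" by auto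
        ultimately show ?thesis by simp
      qed
      moreover have "prob (E k \<inter> space M) = prob (E 0 \<inter> space M)"
        using gen[OF _ _ k, of "{}"] gen[OF _ _ \<open>n > 0\<close>, of "{}"] by (simp add: Gen_def)
      ultimately show ?case using compl.IH k \<open>n > 0\<close> by simp
    next
      case (union A)
      have "(\<lambda>m. prob (E l \<inter> A m)) sums prob (E l \<inter> (\<Union>m. A m))" if "l < n" for l
      proof -
        have "range (\<lambda>m. E l \<inter> A m) \<subseteq> events"
          using union.hyps(2) sig_events E_events[OF that] by auto
        moreover have "disjoint_family (\<lambda>m. E l \<inter> A m)"
          using union.hyps(1) by (auto simp: disjoint_family_on_def)
        ultimately have "(\<lambda>m. prob (E l \<inter> A m)) sums prob (\<Union>m. E l \<inter> A m)"
          by (rule finite_measure_UNION)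
        then show ?thesis by (simp only: Int_UN_distrib)
      qed
      from this[OF k, unfolded union.IH] this[OF \<open>n > 0\<close>] show ?case
        by (rule sums_unique2)
    qed
    define K where "K k = {\<omega> \<in> space M. h (\<lambda>j. X j \<omega>) \<in> J k}" for k
    have K: "K k \<in> sigma_sets (space M) \<G>" for k
      unfolding K_def by (rule hY) (simp add: J_def)
    then have K_events: "K k \<in> events" for k using sig_events by blast
    have "prob Bad \<le> prob (\<Union>k<n. E k \<inter> K k)"
    proof (rule finite_measure_mono_AE)
      show "AE \<omega> in M. \<omega> \<in> Bad \<longrightarrow> \<omega> \<in> (\<Union>k<n. E k \<inter> K k)"
        using order
      proof eventually_elim
        case (elim \<omega>)
        show ?case
        proof
          assume bad: "\<omega> \<in> Bad"
          then obtain k where k: "k < n" "X i \<omega> \<in> J k" using Jcover[of "X i \<omega>"] by (auto simp: Bad_def)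
          with bad elim E_iff[of \<omega> k] show "\<omega> \<in> (\<Union>k<n. E k \<inter> K k)" by (auto simp: Bad_def K_def)
        qed
      qed
      show "(\<Union>k<n. E k \<inter> K k) \<in> events" using E_events K_events by auto
    qed
    also have "\<dots> \<le> (\<Sum>k<n. prob (E k \<inter> K k))"
      using E_events K_events by (intro finite_measure_subadditive_finite) auto
    also have "\<dots> = (\<Sum>k<n. prob (E 0 \<inter> K k))"
      using K by (intro sum.cong refl same) auto
    also have "\<dots> = prob (\<Union>k<n. E 0 \<inter> K k)"
      using E_events[OF that] K_events Jdisj'
      by (intro finite_measure_finite_Union[symmetric]) (auto simp: disjoint_family_on_def K_def)
    also have "\<dots> \<le> prob {\<omega> \<in> space M. point_count X (J 0) \<omega> = of_nat 1}"
    proof (rule finite_measure_mono)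
      have [measurable]: "point_count X (J 0) \<in> borel_measurable M"
        using ab Jsub[OF that] by (intro point_count_measurable[OF pp]) (auto simp: J_def)
      show "{\<omega> \<in> space M. point_count X (J 0) \<omega> = of_nat 1} \<in> events" by measurable
    qed (auto simp: E_def)
    also have "\<dots> = measure lborel (J 0) ^ 1 / fact 1 * exp (- measure lborel (J 0))"
    proof -
      have "J 0 \<in> sets borel" "J 0 \<subseteq> {0..}" using Jsub[OF that] ab by (auto simp: J_def)
      then show ?thesis using pp lJ(2)[of 0] unfolding poisson_points_def by blast
    qed
    also have "\<dots> \<le> d" using d(1) by (simp add: lJ)
    finally show ?thesis by (simp add: d_def)
  qed
  have "prob Bad \<le> 0"
  proof (rule tendsto_lowerbound)
    show "(\<lambda>n. (b - a) / real n) \<longlonglongrightarrow> 0" by (rule lim_const_over_n)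
    show "\<forall>\<^sub>F n in sequentially. prob Bad \<le> (b - a) / real n"
      using eventually_gt_at_top[of 0] by eventually_elim (rule bound)
  qed simp
  then have "emeasure M Bad = 0"
    by (simp add: emeasure_eq_measure measure_le_0_iff)
  then have "AE \<omega> in M. \<omega> \<notin> Bad"
    using Bad by (intro AE_not_in) (auto simp: null_sets_def)
  then show ?thesis
    by (rule AE_mp) (intro AE_I2 impI, simp add: Bad_def)
qed

text \<open>
  Almost surely the points are strictly increasing, so each of them is isolated by an interval \<open>[a, b)\<close> with
  rational endpoints. For the first point \<open>a = 0\<close> serves, which is why the intervals are closed on the left.
\<close>

lemma (in prob_space) AE_point_ne:
  assumes pp: "poisson_points M X"
    and h: "h \<in> borel_measurable (Pi\<^sub>M UNIV (\<lambda>_::nat. borel))" and hupd: "\<And>x c. h (x(i := c)) = (h x :: real)"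
  shows "AE \<omega> in M. X i \<omega> \<noteq> h (\<lambda>j. X j \<omega>)"
proof -
  have "AE \<omega> in M. 0 \<le> real_of_rat a \<and> real_of_rat a < of_rat b \<longrightarrow>
      \<not> ((\<forall>l<i. X l \<omega> < of_rat a) \<and> of_rat a \<le> X i \<omega> \<and> X i \<omega> < of_rat b \<and> of_rat b \<le> X (Suc i) \<omega> \<and>
        X i \<omega> = h (\<lambda>j. X j \<omega>))" for a b
    using AE_isolated_point_ne[OF pp h hupd, of "of_rat a" "of_rat b"]
    by (cases "0 \<le> real_of_rat a \<and> real_of_rat a < of_rat b") auto
  then have "AE \<omega> in M. \<forall>a b. 0 \<le> real_of_rat a \<and> real_of_rat a < of_rat b \<longrightarrow>
      \<not> ((\<forall>l<i. X l \<omega> < of_rat a) \<and> of_rat a \<le> X i \<omega> \<and> X i \<omega> < of_rat b \<and> of_rat b \<le> X (Suc i) \<omega> \<and>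
        X i \<omega> = h (\<lambda>j. X j \<omega>))"
    unfolding AE_all_countable by blast
  moreover have "AE \<omega> in M. 0 \<le> X 0 \<omega> \<and> strict_mono (\<lambda>j. X j \<omega>)"
    using pp by (simp add: poisson_points_def)
  ultimately show ?thesis
  proof eventually_elim
    case (elim \<omega>)
    then have sm: "strict_mono (\<lambda>j. X j \<omega>)" and nn: "0 \<le> X 0 \<omega>" by auto
    obtain a where a: "0 \<le> real_of_rat a" "\<forall>l<i. X l \<omega> < of_rat a" "of_rat a \<le> X i \<omega>"
    proof (cases i)
      case 0
      with nn show ?thesis by (intro that[of 0]) auto
    next
      case (Suc i')
      then have "X i' \<omega> < X i \<omega>" by (simp add: strict_mono_less[OF sm])
      then obtain a where a: "X i' \<omega> < of_rat a" "of_rat a < X i \<omega>"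
        using of_rat_dense by blast
      have le: "X l \<omega> \<le> X i' \<omega>" if "l \<le> i'" for l
        using that by (simp add: strict_mono_less_eq[OF sm])
      show ?thesis
      proof (rule that[of a])
        show "0 \<le> real_of_rat a" using a nn le[of 0, simplified] by linarith
        show "\<forall>l<i. X l \<omega> < of_rat a"
          using le_less_trans[OF le a(1)] Suc by (simp add: less_Suc_eq_le)
      qed (use a in simp)
    qed
    have "X i \<omega> < X (Suc i) \<omega>" by (simp add: strict_mono_less[OF sm])
    then obtain b where b: "X i \<omega> < of_rat b" "of_rat b < X (Suc i) \<omega>"
      using of_rat_dense by blast
    have "real_of_rat a < of_rat b" using a(3) b(1) by (rule le_less_trans)
    with elim(1) a b show ?case by (metis less_imp_le)
  qed
qed

section \<open>Ties have probability zero\<close>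

lemma (in prob_space) distr_pair_indep_elements:
  assumes "indep_elements M N Y N' Y'"
  shows "distr M (N \<Otimes>\<^sub>M N') (\<lambda>\<omega>. (Y \<omega>, Y' \<omega>)) = distr M N Y \<Otimes>\<^sub>M distr M N' Y'"
proof -
  have [measurable]: "Y \<in> M \<rightarrow>\<^sub>M N" "Y' \<in> M \<rightarrow>\<^sub>M N'"
    and ind: "indep_set (sets (vimage_algebra (space M) Y N)) (sets (vimage_algebra (space M) Y' N'))"
    using assms by (auto simp: indep_elements_def)
  interpret Y: prob_space "distr M N Y" by (rule prob_space_distr) simp
  interpret Y': prob_space "distr M N' Y'" by (rule prob_space_distr) simp
  show ?thesis
  proof (rule pair_measure_eqI[symmetric])
    fix A B assume A: "A \<in> sets (distr M N Y)" and B: "B \<in> sets (distr M N' Y')"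
    have "emeasure (distr M (N \<Otimes>\<^sub>M N') (\<lambda>\<omega>. (Y \<omega>, Y' \<omega>))) (A \<times> B) =
        emeasure M ((Y -` A \<inter> space M) \<inter> (Y' -` B \<inter> space M))"
      using A B by (subst emeasure_distr) (auto intro!: arg_cong[where f="emeasure M"])
    also have "\<dots> = emeasure M (Y -` A \<inter> space M) * emeasure M (Y' -` B \<inter> space M)"
      using A B indep_setD[OF ind, of "Y -` A \<inter> space M" "Y' -` B \<inter> space M"]
      by (simp add: emeasure_eq_measure in_vimage_algebra ennreal_mult)
    also have "\<dots> = emeasure (distr M N Y) A * emeasure (distr M N' Y') B"
      using A B by (simp add: emeasure_distr)
    finally show "emeasure (distr M N Y) A * emeasure (distr M N' Y') B =
      emeasure (distr M (N \<Otimes>\<^sub>M N') (\<lambda>\<omega>. (Y \<omega>, Y' \<omega>))) (A \<times> B)" ..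
  qed (simp_all add: Y.sigma_finite_measure_axioms Y'.sigma_finite_measure_axioms cong: sets_pair_measure_cong)
qed

text \<open>
  By independence the joint law of weights and points is a product, so the points can be fixed. The
  equation then determines the weight of \<open>i\<close>, and hence \<open>X i\<close> as its power \<open>- \<alpha>\<close>, from the
  remaining Poisson points.
\<close>

lemma (in prob_space) AE_no_tie:
  fixes \<alpha> :: real
  assumes \<alpha>: "0 < \<alpha>" and pp: "poisson_points M X"
    and ind: "indep_elements M (Pi\<^sub>M UNIV (\<lambda>_. borel)) (\<lambda>\<omega> i. weight \<alpha> X i \<omega>)
           (Pi\<^sub>M UNIV (\<lambda>_. borel)) (\<lambda>\<omega> i. U i \<omega>)"
  shows "AE \<omega> in M. weight \<alpha> X i \<omega> \<noteq>
    enn2real (best_avoiding i (\<lambda>i. weight \<alpha> X i \<omega>) (\<lambda>i. U i \<omega>)) -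
    enn2real (best_through i (\<lambda>i. weight \<alpha> X i \<omega>) (\<lambda>i. U i \<omega>))"
proof -
  define g where "g w u = enn2real (best_avoiding i w u) - enn2real (best_through i w u)" for w u
  define W where "W \<omega> = (\<lambda>j. weight \<alpha> X j \<omega>)" for \<omega>
  define V where "V \<omega> = (\<lambda>j. U j \<omega>)" for \<omega>
  let ?W = "Pi\<^sub>M UNIV (\<lambda>_::nat. borel :: real measure)"
  let ?U = "Pi\<^sub>M UNIV (\<lambda>_::nat. borel :: (real \<times> real) measure)"
  have WV [measurable]: "W \<in> M \<rightarrow>\<^sub>M ?W" "V \<in> M \<rightarrow>\<^sub>M ?U"
    using ind by (simp_all add: indep_elements_def W_def[abs_def] V_def[abs_def])
  have g [measurable]: "(\<lambda>p. g (fst p) (snd p)) \<in> borel_measurable (?W \<Otimes>\<^sub>M ?U)"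
    unfolding g_def
    by (intro borel_measurable_diff borel_measurable_enn2real
        measurable_best_avoiding measurable_best_through) measurable
  define N where "N = {p \<in> space (?W \<Otimes>\<^sub>M ?U). fst p i = g (fst p) (snd p)}"
  have N: "N \<in> sets (?W \<Otimes>\<^sub>M ?U)" unfolding N_def by measurable
  interpret W: prob_space "distr M ?W W" by (rule prob_space_distr) simp
  interpret V: prob_space "distr M ?U V" by (rule prob_space_distr) simp
  interpret pair_sigma_finite "distr M ?W W" "distr M ?U V" ..
  have slice: "emeasure (distr M ?W W) ((\<lambda>w. (w, u)) -` N) = 0" for u
  proof -
    define h where "h x = g (\<lambda>j. x j powr (- 1 / \<alpha>)) u powr (- \<alpha>)" for x :: "nat \<Rightarrow> real"
    have "(\<lambda>x. (\<lambda>j. x j powr (- 1 / \<alpha>), u)) \<in> ?W \<rightarrow>\<^sub>M ?W \<Otimes>\<^sub>M ?U"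
      by (intro measurable_Pair measurable_PiM_single') (auto simp: space_PiM)
    from measurable_compose[OF this g]
    have h: "h \<in> borel_measurable ?W" unfolding h_def by simp
    have hupd: "h (x(i := c)) = h x" for x c
    proof -
      have "(\<lambda>j. (x(i := c)) j powr (- 1 / \<alpha>)) = (\<lambda>j. x j powr (- 1 / \<alpha>))(i := c powr (- 1 / \<alpha>))"
        by auto
      then show ?thesis by (simp add: h_def g_def best_avoiding_upd best_through_upd del: fun_upd_apply)
    qed
    have sliceN: "(\<lambda>w. (w, u)) -` N \<in> sets ?W" using N by (rule sets_Pair2)
    have "AE \<omega> in M. 0 \<le> X 0 \<omega> \<and> strict_mono (\<lambda>j. X j \<omega>)"
      using pp by (simp add: poisson_points_def)
    with AE_point_ne[OF pp h hupd] have "AE \<omega> in M. W \<omega> \<notin> (\<lambda>w. (w, u)) -` N"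
    proof eventually_elim
      case (elim \<omega>)
      \<comment> \<open>This also holds when \<open>X i \<omega> = 0\<close>, since \<open>0 powr _ = 0\<close>.\<close>
      have "0 \<le> X i \<omega>" using elim strict_mono_less_eq[of "\<lambda>j. X j \<omega>" 0 i] by auto
      then have Xi: "X i \<omega> = W \<omega> i powr (- \<alpha>)"
        using \<alpha> by (simp add: W_def weight_def powr_powr)
      have hW: "h (\<lambda>j. X j \<omega>) = g (W \<omega>) u powr (- \<alpha>)"
        by (simp add: h_def W_def weight_def)
      show ?case
      proof
        assume "W \<omega> \<in> (\<lambda>w. (w, u)) -` N"
        then have "W \<omega> i = g (W \<omega>) u" by (simp add: N_def)
        with Xi hW elim(1) show False by metis
      qed
    qed
    moreover have "{w \<in> space ?W. w \<notin> (\<lambda>w. (w, u)) -` N} \<in> sets ?W"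
      using sets.compl_sets[OF sliceN] by (simp only: set_diff_eq)
    ultimately have "AE w in distr M ?W W. w \<notin> (\<lambda>w. (w, u)) -` N"
      by (subst AE_distr_iff[OF WV(1)])
    then have "(\<lambda>w. (w, u)) -` N \<in> null_sets (distr M ?W W)"
      using sliceN by (subst AE_iff_null_sets) auto
    then show ?thesis by (rule null_setsD1)
  qed
  have joint: "distr M (?W \<Otimes>\<^sub>M ?U) (\<lambda>\<omega>. (W \<omega>, V \<omega>)) = distr M ?W W \<Otimes>\<^sub>M distr M ?U V"
    using distr_pair_indep_elements[OF ind] by (simp add: W_def[abs_def] V_def[abs_def])
  have "emeasure M ((\<lambda>\<omega>. (W \<omega>, V \<omega>)) -` N \<inter> space M) = emeasure (distr M ?W W \<Otimes>\<^sub>M distr M ?U V) N"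
    unfolding joint[symmetric] using N by (subst emeasure_distr) auto
  also have "\<dots> = (\<integral>\<^sup>+u. emeasure (distr M ?W W) ((\<lambda>w. (w, u)) -` N) \<partial>distr M ?U V)"
    using N by (intro emeasure_pair_measure_alt2) (simp cong: sets_pair_measure_cong)
  also have "\<dots> = 0" by (simp add: slice)
  finally have "AE \<omega> in M. \<omega> \<notin> (\<lambda>\<omega>. (W \<omega>, V \<omega>)) -` N \<inter> space M"
    using measurable_sets[OF _ N, of "\<lambda>\<omega>. (W \<omega>, V \<omega>)" M] by (intro AE_not_in) (auto simp: null_sets_def)
  then show ?thesis
    using AE_space
  proof eventually_elim
    case (elim \<omega>)
    then show ?case
      by (auto simp: N_def g_def W_def V_def space_pair_measure space_PiM)
  qed
qed

section \<open>Density of the points\<close>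

lemma emeasure_lborel_open_pos:
  fixes R :: "'b :: euclidean_space set"
  assumes "open R" "R \<noteq> {}"
  shows "0 < emeasure lborel R"
proof (rule ccontr)
  assume "\<not> 0 < emeasure lborel R"
  then have "R \<in> null_sets lborel" using assms(1) by (auto simp: null_sets_def)
  then have "negligible R" by (simp add: negligible_iff_null_sets null_sets_completionI)
  with open_not_negligible[OF assms] show False by simp
qed

text \<open>
  It suffices to consider the countably many sets of a topological basis. Index \<open>0\<close> is excluded since the
  weight of the first point is \<open>0\<close> should the Poisson process start at \<open>0\<close>; all later weights are positive.
\<close>

lemma (in prob_space) AE_points_dense:
  assumes iid: "iid_uniform_triangle M U"
  shows "AE \<omega> in M. \<forall>R. open R \<longrightarrow> R \<noteq> {} \<longrightarrow> R \<subseteq> triangle \<longrightarrow> (\<exists>i\<ge>1. U i \<omega> \<in> R)"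
proof -
  have ind: "indep_vars (\<lambda>_. borel) U UNIV" and law: "distr M borel (U i) = uniform_measure lborel triangle" for i
    using iid by (auto simp: iid_uniform_triangle_def)
  have U [measurable]: "random_variable borel (U i)" for i
    using ind by (auto simp: indep_vars_def)
  obtain \<B> :: "(real \<times> real) set set" where \<B>: "countable \<B>" "topological_basis \<B>"
    using ex_countable_basis by auto
  have hit: "AE \<omega> in M. \<exists>i\<ge>1. U i \<omega> \<in> R" if R: "open R" "R \<noteq> {}" "R \<subseteq> triangle" for R
  proof -
    have [measurable]: "R \<in> sets borel" using R(1) by simp
    define p where "p = measure (uniform_measure lborel triangle) R"
    interpret \<mu>: prob_space "uniform_measure lborel triangle" by (rule prob_space_uniform_triangle)
    have "emeasure (uniform_measure lborel triangle) R = emeasure lborel R"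
      using R(3) by (simp add: emeasure_triangle Int_absorb1 divide_ennreal_def)
    then have "ennreal p = emeasure lborel R" by (simp add: p_def \<mu>.emeasure_eq_measure)
    with emeasure_lborel_open_pos[OF R(1,2)] have "0 < ennreal p" by simp
    then have p: "0 < p" by simp
    have miss: "prob (U i -` (- R) \<inter> space M) = 1 - p" for i
    proof -
      have "prob (U i -` (- R) \<inter> space M) = measure (uniform_measure lborel triangle) (- R)"
        unfolding law[of i, symmetric] by (subst measure_distr) auto
      also have "\<dots> = 1 - p"
        using \<mu>.prob_compl[of R] by (simp add: p_def Compl_eq_Diff_UNIV)
      finally show ?thesis .
    qed
    define Z where "Z = {\<omega> \<in> space M. \<forall>i\<ge>1. U i \<omega> \<notin> R}"
    have Z: "Z \<in> events" unfolding Z_def by measurable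
    have "prob Z \<le> (1 - p) ^ n" if "n \<ge> 1" for n
    proof -
      have "prob Z \<le> prob (\<Inter>i\<in>{1..n}. U i -` (- R) \<inter> space M)"
        using that by (intro finite_measure_mono sets.finite_INT) (auto simp: Z_def)
      also have "\<dots> = (\<Prod>i\<in>{1..n}. prob (U i -` (- R) \<inter> space M))"
        using that by (intro indep_varsD[OF ind]) auto
      also have "\<dots> = (1 - p) ^ n" by (simp add: miss)
      finally show ?thesis .
    qed
    moreover have "(\<lambda>n. (1 - p) ^ n) \<longlonglongrightarrow> 0"
      using p by (intro LIMSEQ_power_zero) (simp add: p_def)
    ultimately have "prob Z \<le> 0"
      by (intro tendsto_lowerbound[of "\<lambda>n. (1 - p) ^ n" 0 sequentially])
         (auto simp: eventually_sequentially)
    then have "AE \<omega> in M. \<omega> \<notin> Z"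
      using Z by (intro AE_not_in) (simp add: null_sets_def emeasure_eq_measure measure_le_0_iff)
    then show ?thesis
      using AE_space by eventually_elim (auto simp: Z_def)
  qed
  have "AE \<omega> in M. \<forall>R\<in>{R \<in> \<B>. R \<noteq> {} \<and> R \<subseteq> triangle}. \<exists>i\<ge>1. U i \<omega> \<in> R"
    using \<B> hit topological_basis_open by (subst AE_ball_countable) (auto intro: countable_subset)
  then show ?thesis
  proof eventually_elim
    case (elim \<omega>)
    show ?case
    proof (intro allI impI)
      fix R :: "(real \<times> real) set" assume R: "open R" "R \<noteq> {}" "R \<subseteq> triangle"
      then obtain x where "x \<in> R" by auto
      then obtain B where B: "B \<in> \<B>" "x \<in> B" "B \<subseteq> R"
        using topological_basisE[OF \<B>(2) R(1)] by metis
      have "B \<noteq> {}" "B \<subseteq> triangle" using B R(3) by auto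
      with elim B(1) have "\<exists>i\<ge>1. U i \<omega> \<in> B" by blast
      with B(3) show "\<exists>i\<ge>1. U i \<omega> \<in> R" by blast
    qed
  qed
qed

section \<open>The optimal path\<close>

theorem theorem2p1:
  fixes M :: "'a measure"
    and \<alpha> :: real
    and X :: "nat \<Rightarrow> 'a \<Rightarrow> real"
    and U :: "nat \<Rightarrow> 'a \<Rightarrow> real \<times> real"
  assumes "prob_space M"
    and "0 < \<alpha>" and "\<alpha> < 2"
    and "poisson_points M X"
    and "iid_uniform_triangle M U"
    and "indep_elements M
           (Pi\<^sub>M UNIV (\<lambda>_. borel)) (\<lambda>\<omega> i. weight \<alpha> X i \<omega>)
           (Pi\<^sub>M UNIV (\<lambda>_. borel)) (\<lambda>\<omega> i. U i \<omega>)"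
  shows "max_weight \<alpha> X U \<in> borel_measurable M
    \<and> (AE \<omega> in M. max_weight \<alpha> X U \<omega> < \<infinity>)
    \<and> (AE \<omega> in M. \<exists>!\<gamma>. \<gamma> \<in> paths \<and>
          max_weight \<alpha> X U \<omega> = emeasure (weighted_points \<alpha> X U \<omega>) (path_graph \<gamma>))
    \<and> (AE \<omega> in M. \<exists>\<gamma>\<in>paths.
          max_weight \<alpha> X U \<omega> = emeasure (weighted_points \<alpha> X U \<omega>) (path_graph \<gamma>) \<and>
          (\<forall>\<gamma>'\<in>paths. emeasure (weighted_points \<alpha> X U \<omega>) (path_graph \<gamma>')
             \<le> emeasure (weighted_points \<alpha> X U \<omega>) (path_graph \<gamma>)))"
proof -
  interpret prob_space M by fact
  note pp = assms(4) and iid = assms(5)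
  let ?w = "\<lambda>\<omega> i. weight \<alpha> X i \<omega>" and ?u = "\<lambda>\<omega> i. U i \<omega>"
  have "random_variable borel (U i)" for i
    using iid by (auto simp: iid_uniform_triangle_def indep_vars_def)
  moreover have "weight \<alpha> X i \<in> borel_measurable M" for i
  proof -
    have [measurable]: "X i \<in> borel_measurable M" using pp by (simp add: poisson_points_def)
    show ?thesis unfolding weight_def[abs_def] by measurable
  qed
  ultimately have meas: "max_weight \<alpha> X U \<in> borel_measurable M"
    using measurable_best[of ?w M ?u] by (simp add: max_weight_eq_best[abs_def])
  have order: "AE \<omega> in M. 0 \<le> X 0 \<omega> \<and> strict_mono (\<lambda>i. X i \<omega>)"
    using pp by (simp add: poisson_points_def)
  have weight_antimono: "y powr (- 1 / \<alpha>) \<le> x powr (- 1 / \<alpha>)" if "0 < x" "x \<le> y" for x y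
    using that assms(2) by (intro powr_mono2') auto
  have tails: "AE \<omega> in M. \<forall>e>0. \<exists>N. \<forall>S. collectable (?u \<omega>) S \<longrightarrow> mass (?w \<omega>) (S \<inter> {N..}) \<le> ennreal e"
    using order AE_chains_short[OF iid] AE_points_grow[OF pp]
  proof eventually_elim
    case (elim \<omega>)
    have nonneg: "0 \<le> weight \<alpha> X i \<omega>" for i by (simp add: weight_def)
    have decr: "weight \<alpha> X j \<omega> \<le> weight \<alpha> X i \<omega>" if "1 \<le> i" "i \<le> j" for i j
    proof -
      have "X 0 \<omega> < X i \<omega>" "X i \<omega> \<le> X j \<omega>"
        using that elim(1) by (auto simp: strict_mono_less[of "\<lambda>i. X i \<omega>"] strict_mono_less_eq[of "\<lambda>i. X i \<omega>"])
      with elim(1) show ?thesis unfolding weight_def by (intro weight_antimono) auto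
    qed
    have "\<forall>\<^sub>F m in sequentially. weight \<alpha> X (4 ^ m) \<omega> \<le> (4 ^ m / 2) powr (- 1 / \<alpha>)"
      using elim(3)
    proof eventually_elim
      case (elim m)
      show ?case unfolding weight_def using elim by (intro weight_antimono) simp_all
    qed
    from uniformly_small_tails[OF assms(2,3) nonneg decr elim(2) this] show ?case by blast
  qed
  have attained: "AE \<omega> in M. best (?w \<omega>) (?u \<omega>) < \<infinity> \<and> (\<exists>\<gamma>\<in>paths. mass (?w \<omega>) (hits (?u \<omega>) \<gamma>) = best (?w \<omega>) (?u \<omega>))"
    using tails by eventually_elim (use best_attained in blast)
  have finite: "AE \<omega> in M. max_weight \<alpha> X U \<omega> < \<infinity>"
    using attained by eventually_elim (simp add: max_weight_eq_best)
  have exists: "AE \<omega> in M. \<exists>\<gamma>\<in>paths.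
          max_weight \<alpha> X U \<omega> = emeasure (weighted_points \<alpha> X U \<omega>) (path_graph \<gamma>) \<and>
          (\<forall>\<gamma>'\<in>paths. emeasure (weighted_points \<alpha> X U \<omega>) (path_graph \<gamma>')
             \<le> emeasure (weighted_points \<alpha> X U \<omega>) (path_graph \<gamma>))"
    using attained
  proof eventually_elim
    case (elim \<omega>)
    then obtain \<gamma> where "\<gamma> \<in> paths" "mass (?w \<omega>) (hits (?u \<omega>) \<gamma>) = best (?w \<omega>) (?u \<omega>)" by blast
    then show ?case
      by (intro bexI[of _ \<gamma>])
        (auto simp: max_weight_eq_best emeasure_weighted_points_path mass_le_best collectable_hits)
  qed
  have "AE \<omega> in M. \<forall>i. weight \<alpha> X i \<omega> \<noteq> enn2real (best_avoiding i (?w \<omega>) (?u \<omega>)) - enn2real (best_through i (?w \<omega>) (?u \<omega>))"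
    unfolding AE_all_countable using AE_no_tie[OF assms(2) pp assms(6)] by blast
  with attained AE_points_dense[OF iid] order
  have unique: "AE \<omega> in M. \<exists>!\<gamma>. \<gamma> \<in> paths \<and>
          max_weight \<alpha> X U \<omega> = emeasure (weighted_points \<alpha> X U \<omega>) (path_graph \<gamma>)"
  proof eventually_elim
    case (elim \<omega>)
    have dense: "\<exists>i. 0 < ?w \<omega> i \<and> ?u \<omega> i \<in> R" if R: "open R" "R \<noteq> {}" "R \<subseteq> triangle" for R
    proof -
      obtain i where i: "i \<ge> 1" "U i \<omega> \<in> R" using elim(2) R by blast
      have "X 0 \<omega> < X i \<omega>" using i(1) elim(3) by (auto simp: strict_mono_less[of "\<lambda>i. X i \<omega>"])
      with elim(3) have "0 < weight \<alpha> X i \<omega>" by (auto simp: weight_def)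
      with i show ?thesis by blast
    qed
    obtain \<gamma> where \<gamma>: "\<gamma> \<in> paths" "mass (?w \<omega>) (hits (?u \<omega>) \<gamma>) = best (?w \<omega>) (?u \<omega>)"
      and fin: "best (?w \<omega>) (?u \<omega>) < \<infinity>" using elim(1) by blast
    show ?case
    proof (rule ex1I[of _ \<gamma>])
      show "\<gamma> \<in> paths \<and> max_weight \<alpha> X U \<omega> = emeasure (weighted_points \<alpha> X U \<omega>) (path_graph \<gamma>)"
        using \<gamma> by (simp add: max_weight_eq_best emeasure_weighted_points_path)
      fix \<gamma>' assume "\<gamma>' \<in> paths \<and> max_weight \<alpha> X U \<omega> = emeasure (weighted_points \<alpha> X U \<omega>) (path_graph \<gamma>')"
      then have \<gamma>': "\<gamma>' \<in> paths" "mass (?w \<omega>) (hits (?u \<omega>) \<gamma>') = best (?w \<omega>) (?u \<omega>)"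
        by (simp_all add: max_weight_eq_best emeasure_weighted_points_path)
      have nonneg: "0 \<le> ?w \<omega> i" for i by (simp add: weight_def)
      show "\<gamma>' = \<gamma>"
        by (rule optimal_path_unique[OF fin nonneg dense elim(4)[rule_format] \<gamma>' \<gamma>])
    qed
  qed
  from meas finite unique exists show ?thesis by blast
qed

end
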